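(* Let $a\ge2$, $b\ge2$, let $v$ be the center vertex of the spider $\mathcal S_{a,b}$, choose two pendent vertices of $\mathcal S_{a,b}$ and label the path between them $(1,\dots,2a+1)$, so $v$ has label $a+1$. Let $1\le i<j\le 2a+1$ with $j-i\ge2$, and let $\mathcal S_{a,b}^{\{i,j\}}$ be obtained from $\mathcal S_{a,b}$ by adding the edge $\{i,j\}$. If the cycle of $\mathcal S_{a,b}^{\{i,j\}}$ contains $v$ (i.e. $i\le a+1\le j$), then $\kappa(\mathcal S_{a,b}^{\{i,j\}})-\kappa(\mathcal S_{a,b})<0$.
   Context: For $a\ge1$, $b\ge2$, the spider $\mathcal S_{a,b}$ is the tree consisting of $b$ paths, each with $a$ edges, sharing one common endpoint $v$ (the center). For a connected graph $G$, $\kappa(G)$ is Kemeny's constant of the simple random walk on $G$: $\kappa(G)=\sum_{j\ne i}m_{ij}\pi_j$ ($m_{ij}$ mean first passage time, $\pi$ stationary distribution), independent of $i$. *)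

theory Defs
  imports "HOL-Probability.Probability"
begin

text \<open>Simple undirected graphs; an edge is a two-element set of vertices.\<close>

record 'a ugraph =
  verts :: "'a set"
  edges :: "'a set set"

definition nbrs :: "'a ugraph \<Rightarrow> 'a \<Rightarrow> 'a set" where
  "nbrs G x = {y. {x, y} \<in> edges G}"

definition pendent :: "'a ugraph \<Rightarrow> 'a \<Rightarrow> bool" where
  "pendent G x \<longleftrightarrow> x \<in> verts G \<and> card (nbrs G x) = 1"

definition add_edge :: "'a \<Rightarrow> 'a \<Rightarrow> 'a ugraph \<Rightarrow> 'a ugraph" where
  "add_edge x y G = G\<lparr>edges := insert {x, y} (edges G)\<rparr>"

definition srw_step :: "'a ugraph \<Rightarrow> 'a \<Rightarrow> 'a pmf" where
  "srw_step G x = pmf_of_set (nbrs G x)"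

text \<open>Joint law of the positions \<open>X\<^sub>0, \<dots>, X\<^sub>n\<close> of the simple random walk started at \<open>X\<^sub>0 = x\<close>.\<close>

primrec srw_path :: "'a ugraph \<Rightarrow> nat \<Rightarrow> 'a \<Rightarrow> 'a list pmf" where
  "srw_path G 0 x = return_pmf [x]"
| "srw_path G (Suc n) x = bind_pmf (srw_step G x) (\<lambda>y. map_pmf ((#) x) (srw_path G n y))"

text \<open>Probability that the first visit to \<open>y\<close> at a time \<open>\<ge> 1\<close> happens at time \<open>n\<close>; only
  \<open>n \<ge> 1\<close> is meaningful.\<close>

definition first_passage_prob :: "'a ugraph \<Rightarrow> 'a \<Rightarrow> 'a \<Rightarrow> nat \<Rightarrow> real" where
  "first_passage_prob G x y n =
     measure_pmf.prob (srw_path G n x) {w. w ! n = y \<and> (\<forall>k. 1 \<le> k \<and> k < n \<longrightarrow> w ! k \<noteq> y)}"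

text \<open>On a finite connected graph the first passage time is almost surely finite with finite
  mean, so the series converges to its expectation.\<close>

definition mean_first_passage :: "'a ugraph \<Rightarrow> 'a \<Rightarrow> 'a \<Rightarrow> real" where
  "mean_first_passage G x y = (\<Sum>n. real n * first_passage_prob G x y n)"

definition stationary :: "'a ugraph \<Rightarrow> 'a pmf \<Rightarrow> bool" where
  "stationary G p \<longleftrightarrow> set_pmf p \<subseteq> verts G \<and> bind_pmf p (srw_step G) = p"

definition stationary_dist :: "'a ugraph \<Rightarrow> 'a pmf" where
  "stationary_dist G = (THE p. stationary G p)"

text \<open>The sum is independent of the starting vertex \<open>x\<close> when \<open>G\<close> is finite and connected.\<close>

definition kemeny :: "'a ugraph \<Rightarrow> real" where
  "kemeny G = (THE c. \<forall>x\<in>verts G.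
     (\<Sum>y\<in>verts G - {x}. mean_first_passage G x y * pmf (stationary_dist G) y) = c)"

text \<open>\<open>Leg l d\<close> is the vertex at distance \<open>d \<ge> 1\<close> from the center on the \<open>l\<close>-th leg.\<close>

datatype spider_vertex = Center | Leg nat nat

definition on_leg :: "nat \<Rightarrow> nat \<Rightarrow> spider_vertex" where
  "on_leg l d = (if d = 0 then Center else Leg l d)"

definition spider :: "nat \<Rightarrow> nat \<Rightarrow> spider_vertex ugraph" where
  "spider a b =
     \<lparr>verts = {on_leg l d | l d. l < b \<and> d \<le> a},
      edges = {{on_leg l d, on_leg l (Suc d)} | l d. l < b \<and> d < a}\<rparr>"

text \<open>\<open>p\<close> labels the vertices of a path in \<open>G\<close> by \<open>1, \<dots>, n\<close> in order.\<close>

definition path_labelling :: "'a ugraph \<Rightarrow> nat \<Rightarrow> (nat \<Rightarrow> 'a) \<Rightarrow> bool" where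
  "path_labelling G n p \<longleftrightarrow> p ` {1..n} \<subseteq> verts G \<and> inj_on p {1..n} \<and>
     (\<forall>k\<in>{1..<n}. {p k, p (Suc k)} \<in> edges G)"

end

theory Submission
  imports Defs
begin

text \<open>
  Let \<open>d\<close> be the degree vector of a connected graph with \<open>m\<close> edges and \<open>R\<close> its resistance matrix. The
  function \<open>h x y = (2 m R x y + (R d) y - (R d) x) / 2\<close> solves the hitting time equations, whose
  solution is unique by the maximum principle; averaging over the stationary distribution
  \<open>d y / (2 m)\<close> gives \<open>\<kappa> = d\<^sup>T R d / (4 m)\<close>. A new edge \<open>{i, j}\<close> changes the resistances to
  \<open>R x y - (\<phi> x - \<phi> y)\<^sup>2 / (1 + R i j)\<close>, where \<open>\<phi>\<close> is the potential of a unit current from \<open>i\<close> to \<open>j\<close>.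

  On the spider \<open>R\<close> is the distance. If \<open>s\<close> and \<open>t\<close> are the depths of \<open>i\<close> and \<open>j\<close> on their two legs, then
  \<open>\<phi>\<close> is the depth truncated at \<open>s\<close> on the first leg, minus the depth truncated at \<open>t\<close> on the second
  and \<open>0\<close> elsewhere, so both constants are explicit and the claim becomes a polynomial inequality in
  \<open>a, b, s, t\<close>. It is affine in \<open>b\<close>, and both the slope and the value at \<open>b = 2\<close> have the right sign.
\<close>

subsection \<open>Harmonic functions\<close>

definition deg :: "'a ugraph \<Rightarrow> 'a \<Rightarrow> real" where
  "deg G x = real (card (nbrs G x))"

lemma prob_bind_pmf:
  "measure_pmf.prob (bind_pmf p f) A = measure_pmf.expectation p (\<lambda>x. measure_pmf.prob (f x) A)"
proof -
  have eq: "measure_pmf.prob q A = pmf (map_pmf (\<lambda>x. x \<in> A) q) True" for q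
    by (simp add: pmf_map vimage_def)
  show ?thesis unfolding eq map_bind_pmf pmf_bind ..
qed

text \<open>Two distinct vertices together with \<open>connected\<close> leave no vertex isolated,
  so every degree is positive and \<open>pmf_of_set (nbrs G x)\<close> is a genuine step
  distribution.\<close>

locale connected_graph =
  fixes G :: "'a ugraph"
  assumes finite_verts: "finite (verts G)"
    and nontrivial: "\<exists>x\<in>verts G. \<exists>y\<in>verts G. x \<noteq> y"
    and edge_verts: "{x, y} \<in> edges G \<Longrightarrow> x \<in> verts G \<and> x \<noteq> y"
    and connected: "x \<in> verts G \<Longrightarrow> y \<in> verts G \<Longrightarrow> (x, y) \<in> {(u, v). {u, v} \<in> edges G}\<^sup>*"
begin

abbreviation "V \<equiv> verts G"
abbreviation "N \<equiv> nbrs G"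
abbreviation "d \<equiv> deg G"

lemma mem_nbrs_sym: "x \<in> N y \<longleftrightarrow> y \<in> N x"
  by (simp add: nbrs_def insert_commute)

lemma nbrs_subset: "N x \<subseteq> V"
proof
  fix y assume "y \<in> N x"
  then have "{y, x} \<in> edges G" by (simp add: nbrs_def insert_commute)
  then show "y \<in> V" using edge_verts by blast
qed

lemma finite_nbrs: "finite (N x)"
  using nbrs_subset finite_verts finite_subset by blast

lemma nbrs_nonempty:
  assumes "x \<in> V" shows "N x \<noteq> {}"
proof -
  obtain y where y: "y \<in> V" "y \<noteq> x" using nontrivial by metis
  have "(x, y) \<in> {(u, v). {u, v} \<in> edges G}\<^sup>*" using connected assms y by blast
  then show ?thesis using y(2) by (cases rule: converse_rtranclE) (auto simp: nbrs_def)
qed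

lemma deg_pos: "x \<in> V \<Longrightarrow> d x > 0"
  using nbrs_nonempty finite_nbrs by (simp add: deg_def card_gt_0_iff)

lemma deg_neq_0: "x \<in> V \<Longrightarrow> d x \<noteq> 0"
  using deg_pos by force

text \<open>Maximum principle: a vertex off \<open>y\<close> where the maximum \<open>M\<close> is
  attained passes the value \<open>M\<close> on to all its neighbours, and by connectedness this
  spreads until it reaches \<open>y\<close>.\<close>

lemma harmonic_le:
  assumes y: "y \<in> V" and x: "x \<in> V"
    and harm: "\<And>u. u \<in> V \<Longrightarrow> u \<noteq> y \<Longrightarrow> d u * f u = (\<Sum>z\<in>N u. f z)"
  shows "f x \<le> f y"
proof -
  define M where "M = Max (f ` V)"
  have le: "f u \<le> M" if "u \<in> V" for u
    unfolding M_def using that finite_verts by (intro Max_ge) auto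
  have "M \<in> f ` V" unfolding M_def using finite_verts x by (intro Max_in) auto
  then obtain u where u: "u \<in> V" "f u = M" by auto
  \<comment> \<open>The disjunct \<open>f y = M\<close> covers walks that pass through
    \<open>y\<close>, where the mean value property is not assumed.\<close>
  have "v \<in> V \<and> (f y = M \<or> f v = M)" if "(u, v) \<in> {(u, v). {u, v} \<in> edges G}\<^sup>*" for v
    using that
  proof (induction rule: rtrancl_induct)
    case base
    then show ?case using u by simp
  next
    case (step v z)
    have z: "z \<in> N v" using step.hyps(2) by (simp add: nbrs_def)
    have "f z = M" if "f y \<noteq> M"
    proof -
      have v: "v \<in> V" "f v = M" "v \<noteq> y" using step.IH that by (simp, simp, metis)
      have "(\<Sum>z\<in>N v. M - f z) = d v * M - d v * f v"
        using harm[OF v(1,3)] by (simp add: sum_subtractf deg_def)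
      then have "(\<Sum>z\<in>N v. M - f z) = 0" by (simp only: v(2) diff_self)
      moreover have "0 \<le> M - f z" if "z \<in> N v" for z
        using le[OF subsetD[OF nbrs_subset that]] by simp
      ultimately have "M - f z = 0"
        using sum_nonneg_0[OF finite_nbrs, where f = "\<lambda>z. M - f z"] z by metis
      then show ?thesis by simp
    qed
    then show ?case using subsetD[OF nbrs_subset z] by blast
  qed
  from this[OF connected[OF u(1) y]] have "f y = M" by blast
  then show ?thesis using le[OF x] by simp
qed

text \<open>The maximum principle for \<open>f\<close> and for \<open>- f\<close>. Applied to a
  difference of two solutions it gives uniqueness for the linear systems below.\<close>

lemma harmonic_eq:
  assumes "y \<in> V" "x \<in> V"
    and "\<And>u. u \<in> V \<Longrightarrow> u \<noteq> y \<Longrightarrow> d u * f u = (\<Sum>z\<in>N u. f z)"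
  shows "f x = f y"
proof (rule antisym)
  show "f x \<le> f y" by (rule harmonic_le[where f = f, OF assms])
  have "d u * - f u = (\<Sum>z\<in>N u. - f z)" if "u \<in> V" "u \<noteq> y" for u
    using assms(3)[OF that] by (simp add: sum_negf)
  from harmonic_le[where f = "\<lambda>z. - f z", OF assms(1,2) this] show "f y \<le> f x" by simp
qed

definition vol :: real where "vol = (\<Sum>x\<in>V. d x)"

lemma vol_pos: "vol > 0"
proof -
  have "V \<noteq> {}" using nontrivial by blast
  then show ?thesis unfolding vol_def using finite_verts deg_pos by (intro sum_pos)
qed

subsection \<open>Stationary distribution\<close>

lemma pmf_bind_srw_step:
  assumes "set_pmf p \<subseteq> V"
  shows "pmf (bind_pmf p (srw_step G)) y = (\<Sum>x\<in>N y. pmf p x / d x)"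
proof -
  have "pmf (bind_pmf p (srw_step G)) y = (\<Sum>x\<in>V. pmf p x * pmf (srw_step G x) y)"
    unfolding pmf_bind using assms finite_verts
    by (subst integral_measure_pmf[of V]) auto
  also have "\<dots> = (\<Sum>x\<in>V. if x \<in> N y then pmf p x / d x else 0)"
    using nbrs_nonempty finite_nbrs mem_nbrs_sym[of y]
    by (intro sum.cong refl) (auto simp: srw_step_def deg_def indicator_def)
  also have "\<dots> = (\<Sum>x\<in>N y. pmf p x / d x)"
    using nbrs_subset[of y] finite_verts by (simp add: sum.inter_restrict[symmetric] Int_absorb1)
  finally show ?thesis .
qed

text \<open>Stationarity says that \<open>pmf p x / d x\<close> satisfies the mean value property at
  every vertex, so it is constant; normalization makes the constant \<open>1 / vol\<close>.\<close>

lemma stationary_unique: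
  assumes "stationary G p" "y \<in> V"
  shows "pmf p y = d y / vol"
proof -
  have sub: "set_pmf p \<subseteq> V" and st: "bind_pmf p (srw_step G) = p"
    using assms by (auto simp: stationary_def)
  let ?q = "\<lambda>x. pmf p x / d x"
  have "d x * ?q x = (\<Sum>z\<in>N x. ?q z)" if "x \<in> V" for x
    using pmf_bind_srw_step[OF sub, of x] st deg_pos[OF that] by simp
  then have q: "?q x = ?q y" if "x \<in> V" for x
    using that assms(2) harmonic_eq[of y x ?q] by blast
  have "1 = (\<Sum>x\<in>V. pmf p x)" using sum_pmf_eq_1[OF finite_verts sub] by simp
  also have "\<dots> = (\<Sum>x\<in>V. d x * ?q y)"
  proof (intro sum.cong refl)
    fix x assume "x \<in> V"
    then show "pmf p x = d x * ?q y" using q[of x] deg_neq_0[of x] by (simp add: field_simps)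
  qed
  also have "\<dots> = vol * ?q y" unfolding vol_def by (rule sum_distrib_right[symmetric])
  finally show ?thesis using vol_pos deg_pos[OF assms(2)] by (simp add: field_simps)
qed

lemma stationary_exists: "\<exists>p. stationary G p"
proof -
  let ?f = "\<lambda>x. if x \<in> V then d x / vol else 0"
  have nn: "0 \<le> ?f x" for x using vol_pos deg_pos[of x] by auto
  have "(\<integral>\<^sup>+x. ennreal (?f x) \<partial>count_space UNIV) = (\<Sum>x\<in>V. ennreal (?f x))"
    using finite_verts by (intro nn_integral_count_space') auto
  also have "\<dots> = ennreal (\<Sum>x\<in>V. ?f x)" by (rule sum_ennreal[OF nn])
  also have "(\<Sum>x\<in>V. ?f x) = 1" using vol_pos by (simp add: vol_def sum_divide_distrib[symmetric])
  finally have one: "(\<integral>\<^sup>+x. ennreal (?f x) \<partial>count_space UNIV) = 1" by simp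
  define p where "p = embed_pmf ?f"
  have pmf: "pmf p x = ?f x" for x
    unfolding p_def by (rule pmf_embed_pmf[OF nn one])
  have sub: "set_pmf p \<subseteq> V" using pmf by (auto simp: set_pmf_eq split: if_splits)
  have "pmf (bind_pmf p (srw_step G)) y = pmf p y" for y
  proof -
    have "(\<Sum>x\<in>N y. pmf p x / d x) = (\<Sum>x\<in>N y. 1 / vol)"
      using nbrs_subset[of y] deg_neq_0 by (intro sum.cong refl) (auto simp: pmf)
    also have "\<dots> = d y / vol" by (simp add: deg_def)
    also have "\<dots> = pmf p y"
    \<comment> \<open>Outside \<open>V\<close> the neighbourhood is empty, so the degree is
      \<open>0\<close> and agrees with the default value of \<open>?f\<close>.\<close>
    proof (cases "y \<in> V")
      case False
      then have "N y = {}" using nbrs_subset mem_nbrs_sym by blast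
      then show ?thesis using False by (simp add: pmf deg_def)
    qed (simp add: pmf)
    finally show ?thesis using pmf_bind_srw_step[OF sub] by simp
  qed
  then show ?thesis using sub by (unfold stationary_def) (blast intro: pmf_eqI)
qed

lemma pmf_stationary_dist:
  assumes "y \<in> V"
  shows "pmf (stationary_dist G) y = d y / vol"
proof -
  obtain p where p: "stationary G p" using stationary_exists by blast
  have "q = p" if q: "stationary G q" for q
  proof (rule pmf_eqI)
    fix x
    show "pmf q x = pmf p x"
    proof (cases "x \<in> V")
      case True
      then show ?thesis using stationary_unique p q by simp
    next
      case False
      then have "x \<notin> set_pmf q" "x \<notin> set_pmf p" using p q by (auto simp: stationary_def)
      then show ?thesis by (simp add: set_pmf_iff)
    qed
  qed
  then have "stationary_dist G = p" unfolding stationary_dist_def using p by blast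
  then show ?thesis using stationary_unique p assms by simp
qed

subsection \<open>Mean first passage times\<close>

lemma srw_path_nth_0: "w \<in> set_pmf (srw_path G n x) \<Longrightarrow> w ! 0 = x"
  by (cases n) auto

text \<open>First-step analysis: condition on the first position \<open>z\<close>. If
  \<open>z = y\<close>, the passage has already happened at time 1, which is compatible only with
  \<open>n = 0\<close>.\<close>

lemma first_passage_prob_Suc:
  assumes "x \<in> V"
  shows "first_passage_prob G x y (Suc n) =
    (\<Sum>z\<in>N x. if z = y then of_bool (n = 0) else first_passage_prob G z y n) / d x"
proof -
  let ?A = "\<lambda>n. {w. w ! n = y \<and> (\<forall>k. 1 \<le> k \<and> k < n \<longrightarrow> w ! k \<noteq> y)}"
  have 1: "measure_pmf.prob (srw_path G n z) ((#) x -` ?A (Suc n)) =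
      (if z = y then of_bool (n = 0) else first_passage_prob G z y n)" for z
  proof -
    have "measure_pmf.prob (srw_path G n z) ((#) x -` ?A (Suc n)) =
        measure_pmf.prob (srw_path G n z) (if z = y then (if n = 0 then UNIV else {}) else ?A n)"
    \<comment> \<open>The two events differ as sets of lists, but agree on those starting with
      \<open>z\<close>, which carry all the mass.\<close>
    proof (rule measure_pmf.finite_measure_eq_AE)
      show "AE w in measure_pmf (srw_path G n z). w \<in> (#) x -` ?A (Suc n) \<longleftrightarrow>
          w \<in> (if z = y then (if n = 0 then UNIV else {}) else ?A n)"
      proof (rule AE_pmfI)
        fix w assume "w \<in> set_pmf (srw_path G n z)"
        then have w0: "w ! 0 = z" by (rule srw_path_nth_0)
        \<comment> \<open>Dropping the head \<open>x\<close> shifts time by one, so time 0 of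
          \<open>w\<close> now falls under the avoidance condition.\<close>
        have "w \<in> (#) x -` ?A (Suc n) \<longleftrightarrow> w ! n = y \<and> (\<forall>k<n. w ! k \<noteq> y)"
        proof -
          have "(\<forall>k. 1 \<le> k \<and> k < Suc n \<longrightarrow> (x # w) ! k \<noteq> y) \<longleftrightarrow> (\<forall>k<n. w ! k \<noteq> y)"
            by (auto simp: nth_Cons split: nat.split)
          then show ?thesis by simp
        qed
        also have "\<dots> \<longleftrightarrow> w \<in> (if z = y then (if n = 0 then UNIV else {}) else ?A n)"
        proof (cases "n = 0 \<or> z = y")
          case True
          then show ?thesis using w0 by auto
        next
          case False
          then have "(\<forall>k<n. w ! k \<noteq> y) \<longleftrightarrow> (\<forall>k. 1 \<le> k \<and> k < n \<longrightarrow> w ! k \<noteq> y)"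
            using w0 by (metis less_one linorder_le_less_linear)
          then show ?thesis using False by simp
        qed
        finally show "w \<in> (#) x -` ?A (Suc n) \<longleftrightarrow>
          w \<in> (if z = y then (if n = 0 then UNIV else {}) else ?A n)" .
      qed
    qed auto
    then show ?thesis by (auto simp: first_passage_prob_def)
  qed
  have "first_passage_prob G x y (Suc n) =
      measure_pmf.expectation (srw_step G x)
        (\<lambda>z. measure_pmf.prob (srw_path G n z) ((#) x -` ?A (Suc n)))"
    unfolding first_passage_prob_def srw_path.simps prob_bind_pmf measure_map_pmf ..
  also have "\<dots> = (\<Sum>z\<in>N x. if z = y then of_bool (n = 0) else first_passage_prob G z y n) / d x"
    unfolding 1 srw_step_def deg_def
    using nbrs_nonempty[OF assms] finite_nbrs by (subst integral_pmf_of_set) auto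
  finally show ?thesis .
qed

text \<open>At a minimum other than \<open>y\<close> the average over the neighbours could not be
  smaller by 1, so the minimum is \<open>h y = 0\<close>.\<close>

lemma hitting_system_nonneg:
  assumes y: "y \<in> V" "h y = 0"
    and h: "\<And>u. u \<in> V \<Longrightarrow> u \<noteq> y \<Longrightarrow> d u * h u = d u + (\<Sum>z\<in>N u. h z)"
    and x: "x \<in> V"
  shows "0 \<le> h x"
proof -
  define m where "m = arg_min_on h V"
  have "V \<noteq> {}" using x by blast
  then have m: "m \<in> V" "\<And>u. u \<in> V \<Longrightarrow> h m \<le> h u"
    unfolding m_def by (rule arg_min_if_finite(1)[OF finite_verts], rule arg_min_least[OF finite_verts])
  have "m = y"
  proof (rule ccontr)
    assume "m \<noteq> y"
    have "d m * h m = (\<Sum>z\<in>N m. h m)" by (simp add: deg_def)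
    also have "\<dots> \<le> (\<Sum>z\<in>N m. h z)" by (rule sum_mono) (use m nbrs_subset in blast)
    also have "\<dots> < d m * h m" using h[OF m(1) \<open>m \<noteq> y\<close>] deg_pos[OF m(1)] by simp
    finally show False by simp
  qed
  then show ?thesis using m(2)[OF x] y(2) by simp
qed

text \<open>A solution \<open>h\<close> of the hitting time equations first serves as an upper bound
  that makes the series converge; the limit solves the same equations, hence equals \<open>h\<close>
  by uniqueness.\<close>

theorem mean_first_passage_eq:
  assumes y: "y \<in> V" "h y = 0"
    and h: "\<And>u. u \<in> V \<Longrightarrow> u \<noteq> y \<Longrightarrow> d u * h u = d u + (\<Sum>z\<in>N u. h z)"
    and x: "x \<in> V" "x \<noteq> y"
  shows "mean_first_passage G x y = h x"
proof -
  define g where "g n x = first_passage_prob G x y n" for n x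
  \<comment> \<open>For the passage time \<open>T\<close>, \<open>B n x\<close> is the probability
    of \<open>T \<le> n\<close>, and \<open>A n x\<close> is the expectation of \<open>T\<close>
    restricted to that event. Time 0 is left out, since \<open>g 0 y = 1\<close> is
    meaningless.\<close>
  define B where "B n x = (\<Sum>k<n. g (Suc k) x)" for n x
  define A where "A n x = (\<Sum>k<n. real (Suc k) * g (Suc k) x)" for n x
  have g_nonneg: "0 \<le> g n x" for n x by (simp add: g_def first_passage_prob_def)
  have g_0: "g 0 z = 0" if "z \<noteq> y" for z
    using that by (simp add: g_def first_passage_prob_def)
  have g_Suc: "d x * g (Suc n) x = (\<Sum>z\<in>N x. if z = y then of_bool (n = 0) else g n z)"
    if "x \<in> V" for x n
    using deg_neq_0[OF that] by (simp only: g_def first_passage_prob_Suc[OF that]) simp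
  \<comment> \<open>Weight \<open>1\<close> yields the recursion for \<open>B\<close>. Weight
    \<open>Suc k\<close> yields that for \<open>A\<close>: the shift raises each weight by one, and
    the excess is a copy of \<open>B\<close>.\<close>
  have weighted_Suc: "d x * (\<Sum>k<Suc n. w k * g (Suc k) x) =
      (\<Sum>z\<in>N x. if z = y then w 0 else (\<Sum>k<n. w (Suc k) * g (Suc k) z))"
    if "x \<in> V" for x n and w :: "nat \<Rightarrow> real"
  proof -
    have "d x * (\<Sum>k<Suc n. w k * g (Suc k) x) =
        (\<Sum>k<Suc n. w k * (\<Sum>z\<in>N x. if z = y then of_bool (k = 0) else g k z))"
      unfolding g_Suc[OF that, symmetric]
      by (simp add: sum_distrib_left mult.left_commute del: sum.lessThan_Suc)
    also have "\<dots> = (\<Sum>z\<in>N x. \<Sum>k<Suc n. w k * (if z = y then of_bool (k = 0) else g k z))"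
      unfolding sum_distrib_left by (rule sum.swap)
    also have "\<dots> = (\<Sum>z\<in>N x. if z = y then w 0 else (\<Sum>k<n. w (Suc k) * g (Suc k) z))"
      by (intro sum.cong refl) (simp add: sum.lessThan_Suc_shift g_0 del: sum.lessThan_Suc)
    finally show ?thesis .
  qed
  have B_Suc: "d x * B (Suc n) x = (\<Sum>z\<in>N x. if z = y then 1 else B n z)" if "x \<in> V" for x n
    using weighted_Suc[OF that, of "\<lambda>_. 1" n] by (simp add: B_def cong: if_cong del: sum.lessThan_Suc)
  have A_Suc: "d x * A (Suc n) x = (\<Sum>z\<in>N x. if z = y then 1 else A n z + B n z)"
    if "x \<in> V" for x n
  proof -
    have AB: "A n z + B n z = (\<Sum>k<n. real (Suc (Suc k)) * g (Suc k) z)" for z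
      unfolding A_def B_def sum.distrib[symmetric] by (intro sum.cong refl) (simp add: algebra_simps)
    show ?thesis
      unfolding AB using weighted_Suc[OF that, of "\<lambda>k. real (Suc k)" n] by (simp add: A_def cong: if_cong del: sum.lessThan_Suc)
  qed
  have B_le: "B n x \<le> 1" if "x \<in> V" for n x
    using that
  proof (induction n arbitrary: x)
    case 0
    then show ?case by (simp add: B_def)
  next
    case (Suc n)
    have "d x * B (Suc n) x \<le> (\<Sum>z\<in>N x. 1)"
      unfolding B_Suc[OF Suc.prems] using Suc.IH nbrs_subset by (intro sum_mono) auto
    then have "d x * B (Suc n) x \<le> d x * 1" by (simp add: deg_def)
    then show ?case using deg_pos[OF Suc.prems] by (simp only: mult_le_cancel_left_pos)
  qed
  have A_le: "A n x \<le> h x" if "x \<in> V" "x \<noteq> y" for n x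
    using that
  proof (induction n arbitrary: x)
    case 0
    then show ?case using hitting_system_nonneg[where h = h, OF y h] by (simp add: A_def)
  next
    case (Suc n)
    have "d x * A (Suc n) x \<le> (\<Sum>z\<in>N x. 1 + h z)"
      unfolding A_Suc[OF Suc.prems(1)]
    proof (rule sum_mono)
      fix z assume "z \<in> N x"
      then have "z \<in> V" using nbrs_subset by blast
      then show "(if z = y then 1 else A n z + B n z) \<le> 1 + h z"
        using Suc.IH[of z] B_le[of z n] y(2) by auto
    qed
    also have "\<dots> = d x * h x" using h[OF Suc.prems] by (simp add: sum.distrib deg_def)
    finally show ?case using deg_pos[OF Suc.prems(1)] by (simp only: mult_le_cancel_left_pos)
  qed
  define B' where "B' x = (\<Sum>k. g (Suc k) x)" for x
  define A' where "A' x = (\<Sum>k. real (Suc k) * g (Suc k) x)" for x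
  have B_lim: "(\<lambda>n. B n x) \<longlonglongrightarrow> B' x" if "x \<in> V" for x
    unfolding B_def B'_def using g_nonneg B_le[OF that, unfolded B_def]
    by (intro summable_LIMSEQ summableI_nonneg_bounded)
  have A_summable: "summable (\<lambda>k. real (Suc k) * g (Suc k) x)" if "x \<in> V" "x \<noteq> y" for x
    using g_nonneg A_le[OF that, unfolded A_def]
    by (intro summableI_nonneg_bounded[where x = "h x"]) auto
  have A_lim: "(\<lambda>n. A n x) \<longlonglongrightarrow> A' x" if "x \<in> V" "x \<noteq> y" for x
    unfolding A_def A'_def using A_summable[OF that] by (rule summable_LIMSEQ)
  \<comment> \<open>Almost sure hitting: with the value 1 put at \<open>y\<close>, \<open>B'\<close>
    has the mean value property off \<open>y\<close> and is therefore constant.\<close>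
  have B'_eq: "B' x = 1" if "x \<in> V" "x \<noteq> y" for x
  proof -
    let ?f = "\<lambda>z. if z = y then 1 else B' z"
    have "d u * ?f u = (\<Sum>z\<in>N u. ?f z)" if "u \<in> V" "u \<noteq> y" for u
    proof (rule LIMSEQ_unique)
      show "(\<lambda>n. d u * B (Suc n) u) \<longlonglongrightarrow> d u * ?f u"
        using that LIMSEQ_Suc[OF B_lim[OF that(1)]] by (auto intro!: tendsto_intros)
      show "(\<lambda>n. d u * B (Suc n) u) \<longlonglongrightarrow> (\<Sum>z\<in>N u. ?f z)"
        unfolding B_Suc[OF that(1)] using B_lim nbrs_subset by (intro tendsto_sum) auto
    qed
    from harmonic_eq[where f = ?f, OF y(1) that(1) this] show ?thesis using that by simp
  qed
  have "A' x = h x"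
  proof -
    \<comment> \<open>The inhomogeneous terms of the two systems cancel because
      \<open>B' = 1\<close>, so this difference has the mean value property off
      \<open>y\<close>.\<close>
    let ?f = "\<lambda>z. if z = y then 0 else A' z - h z"
    have "d u * ?f u = (\<Sum>z\<in>N u. ?f z)" if "u \<in> V" "u \<noteq> y" for u
    proof -
      have "d u * A' u = (\<Sum>z\<in>N u. if z = y then 1 else A' z + B' z)"
      proof (rule LIMSEQ_unique)
        show "(\<lambda>n. d u * A (Suc n) u) \<longlonglongrightarrow> d u * A' u"
          using LIMSEQ_Suc[OF A_lim[OF that]] by (intro tendsto_intros)
        show "(\<lambda>n. d u * A (Suc n) u) \<longlonglongrightarrow> (\<Sum>z\<in>N u. if z = y then 1 else A' z + B' z)"
          unfolding A_Suc[OF that(1)] using A_lim B_lim nbrs_subset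
          by (intro tendsto_sum) (auto intro!: tendsto_intros)
      qed
      also have "\<dots> = (\<Sum>z\<in>N u. 1 + (?f z + h z))"
        using B'_eq nbrs_subset y(2) by (intro sum.cong refl) auto
      also have "\<dots> = (\<Sum>z\<in>N u. ?f z) + d u * h u"
        unfolding h[OF that] sum.distrib by (simp add: deg_def)
      finally show ?thesis using that by (simp add: algebra_simps)
    qed
    from harmonic_eq[where f = ?f, OF y(1) x(1) this] show ?thesis using x by simp
  qed
  \<comment> \<open>The term at \<open>n = 0\<close> vanishes through its factor, so starting the
    series at 0 changes nothing.\<close>
  moreover have "(\<lambda>n. real n * g n x) sums A' x"
    using summable_sums[OF A_summable[OF x]] by (subst (asm) sums_Suc_iff) (simp add: A'_def)
  ultimately show ?thesis by (simp add: mean_first_passage_def g_def sums_iff)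
qed

end

subsection \<open>Kemeny's constant and resistances\<close>

text \<open>The properties of the effective resistance \<open>R\<close> that determine Kemeny's constant; on a tree
  \<open>R\<close> is the distance and \<open>c x = 2 - deg x\<close>.\<close>

definition resistance :: "'a ugraph \<Rightarrow> ('a \<Rightarrow> 'a \<Rightarrow> real) \<Rightarrow> bool" where
  "resistance G R \<longleftrightarrow>
    (\<forall>x\<in>verts G. R x x = 0) \<and>
    (\<forall>x\<in>verts G. \<forall>y\<in>verts G. R x y = R y x) \<and>
    (\<exists>c. \<forall>x\<in>verts G. \<forall>y\<in>verts G.
      (\<Sum>z\<in>nbrs G x. R x y - R z y) = c x - (if x = y then 2 else 0))"

context connected_graph
begin

theorem kemeny_resistance:
  assumes R: "resistance G R"
  shows "kemeny G = (\<Sum>y\<in>V. d y * (\<Sum>z\<in>V. d z * R y z)) / (2 * vol)"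
proof -
  from R obtain c where c: "\<And>x y. x \<in> V \<Longrightarrow> y \<in> V \<Longrightarrow>
      (\<Sum>z\<in>N x. R x y - R z y) = c x - (if x = y then 2 else 0)"
    unfolding resistance_def by blast
  have R0: "R x x = 0" if "x \<in> V" for x using R that by (simp add: resistance_def)
  have Rsym: "R x y = R y x" if "x \<in> V" "y \<in> V" for x y using R that by (simp add: resistance_def)
  define S where "S x = (\<Sum>z\<in>V. d z * R x z)" for x
  \<comment> \<open>The Laplacian of \<open>R _ y\<close> at \<open>u \<noteq> y\<close> is
    \<open>c u\<close> and that of \<open>S\<close> is \<open>vol * c u - 2 * d u\<close>, so in
    this combination the unknown \<open>c\<close> cancels and \<open>d u\<close> remains. The term
    \<open>S y\<close> ensures \<open>h y y = 0\<close>.\<close>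
  define h where "h y x = (vol * R x y + S y - S x) / 2" for x y
  have hyy: "h y y = 0" if "y \<in> V" for y using R0[OF that] by (simp add: h_def)
  have h: "d u * h y u = d u + (\<Sum>z\<in>N u. h y z)" if "y \<in> V" "u \<in> V" "u \<noteq> y" for u y
  proof -
    have "(\<Sum>z\<in>N u. S u - S z) = (\<Sum>z\<in>N u. \<Sum>v\<in>V. d v * (R u v - R z v))"
      by (simp add: S_def sum_subtractf right_diff_distrib)
    also have "\<dots> = (\<Sum>v\<in>V. \<Sum>z\<in>N u. d v * (R u v - R z v))" by (rule sum.swap)
    also have "\<dots> = (\<Sum>v\<in>V. d v * (c u - (if u = v then 2 else 0)))"
      by (intro sum.cong refl) (simp only: sum_distrib_left[symmetric] c that)
    also have "\<dots> = (\<Sum>v\<in>V. d v * c u - (if u = v then 2 * d v else 0))"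
      by (intro sum.cong refl) (simp add: algebra_simps)
    also have "\<dots> = vol * c u - 2 * d u"
      using finite_verts that by (simp add: sum_subtractf vol_def sum_distrib_right)
    finally have S: "(\<Sum>z\<in>N u. S u - S z) = vol * c u - 2 * d u" .
    have "d u * h y u - (\<Sum>z\<in>N u. h y z) = (\<Sum>z\<in>N u. h y u - h y z)"
      by (simp add: sum_subtractf deg_def)
    also have "\<dots> = (\<Sum>z\<in>N u. vol / 2 * (R u y - R z y) - (S u - S z) / 2)"
      by (intro sum.cong refl) (simp add: h_def field_simps)
    also have "\<dots> = vol / 2 * (\<Sum>z\<in>N u. R u y - R z y) - (\<Sum>z\<in>N u. S u - S z) / 2"
      by (simp only: sum_subtractf[of _ "\<lambda>z. (S u - S z) / 2"] sum_distrib_left sum_divide_distrib)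
    also have "\<dots> = d u" unfolding S using c[of u y] that by (simp add: field_simps)
    finally show ?thesis by simp
  qed
  have "(\<Sum>y\<in>V - {x}. mean_first_passage G x y * pmf (stationary_dist G) y) =
      (\<Sum>y\<in>V. d y * S y) / (2 * vol)" if x: "x \<in> V" for x
  proof -
    have "(\<Sum>y\<in>V - {x}. mean_first_passage G x y * pmf (stationary_dist G) y) =
        (\<Sum>y\<in>V - {x}. h y x * (d y / vol))"
    proof (intro sum.cong refl)
      fix y assume y: "y \<in> V - {x}"
      then have "mean_first_passage G x y = h y x"
        using x by (intro mean_first_passage_eq hyy h) auto
      then show "mean_first_passage G x y * pmf (stationary_dist G) y = h y x * (d y / vol)"
        using pmf_stationary_dist y by simp
    qed
    \<comment> \<open>The term \<open>y = x\<close> may be added because \<open>h x x = 0\<close>.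
      In the full sum the contributions of \<open>S x\<close> cancel, which is why the result does
      not depend on \<open>x\<close>.\<close>
    also have "\<dots> = (\<Sum>y\<in>V. h y x * (d y / vol))"
      using finite_verts x hyy[OF x] by (simp add: sum.remove[of V x])
    also have "\<dots> = (\<Sum>y\<in>V. d y * R x y / 2 + d y * S y / (2 * vol) - d y * (S x / (2 * vol)))"
      using vol_pos by (intro sum.cong refl) (simp add: h_def field_simps)
    also have "\<dots> = S x / 2 + (\<Sum>y\<in>V. d y * S y) / (2 * vol) - vol * (S x / (2 * vol))"
      unfolding sum_subtractf sum.distrib
      by (simp add: S_def[of x] vol_def sum_divide_distrib[symmetric] sum_distrib_right[symmetric])
    also have "\<dots> = (\<Sum>y\<in>V. d y * S y) / (2 * vol)" using vol_pos by simp
    finally show ?thesis .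
  qed
  moreover have "V \<noteq> {}" using nontrivial by blast
  ultimately show ?thesis unfolding kemeny_def S_def[symmetric] by (intro the_equality) auto
qed

section \<open>Adding an edge\<close>

context
  fixes i j
  assumes ij: "i \<in> V" "j \<in> V" "i \<noteq> j" "{i, j} \<notin> edges G"
begin

lemma nbrs_add_edge:
  "nbrs (add_edge i j G) x = N x \<union> (if x = i then {j} else {}) \<union> (if x = j then {i} else {})"
  using ij by (auto simp: nbrs_def add_edge_def doubleton_eq_iff)

lemma sum_nbrs_add_edge:
  "(\<Sum>z\<in>nbrs (add_edge i j G) x. f z) =
    (\<Sum>z\<in>N x. f z) + (if x = i then f j else 0) + (if x = j then f i else (0 :: real))"
proof -
  have "j \<notin> N i" "i \<notin> N j" using ij by (auto simp: nbrs_def insert_commute)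
  then show ?thesis unfolding nbrs_add_edge using finite_nbrs ij by auto
qed

lemma verts_add_edge: "verts (add_edge i j G) = V"
  by (simp add: add_edge_def)

lemma deg_add_edge: "deg (add_edge i j G) x = d x + (if x = i then 1 else 0) + (if x = j then 1 else 0)"
  using sum_nbrs_add_edge[of "\<lambda>_. 1" x] by (simp add: deg_def)

lemma sum_deg_add_edge:
  "(\<Sum>x\<in>V. deg (add_edge i j G) x * f x) = (\<Sum>x\<in>V. d x * f x) + f i + f j"
proof -
  have "(\<Sum>x\<in>V. deg (add_edge i j G) x * f x) =
      (\<Sum>x\<in>V. d x * f x + (if x = i then f x else 0) + (if x = j then f x else 0))"
    unfolding deg_add_edge by (intro sum.cong refl) (auto simp: algebra_simps)
  then show ?thesis using finite_verts ij by (simp add: sum.distrib)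
qed

lemma connected_graph_add_edge: "connected_graph (add_edge i j G)"
proof
  show "finite (verts (add_edge i j G))" using finite_verts by (simp add: verts_add_edge)
  show "\<exists>x\<in>verts (add_edge i j G). \<exists>y\<in>verts (add_edge i j G). x \<noteq> y"
    using nontrivial by (simp add: verts_add_edge)
  show "x \<in> verts (add_edge i j G) \<and> x \<noteq> y" if "{x, y} \<in> edges (add_edge i j G)" for x y
    using that ij edge_verts[of x y] by (auto simp: add_edge_def doubleton_eq_iff)
  show "(x, y) \<in> {(u, v). {u, v} \<in> edges (add_edge i j G)}\<^sup>*"
    if "x \<in> verts (add_edge i j G)" "y \<in> verts (add_edge i j G)" for x y
  proof -
    have "{(u, v). {u, v} \<in> edges G} \<subseteq> {(u, v). {u, v} \<in> edges (add_edge i j G)}"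
      by (auto simp: add_edge_def)
    from rtrancl_mono[OF this] show ?thesis
      using connected that by (auto simp: verts_add_edge)
  qed
qed

context
  fixes R \<phi>
  assumes R: "resistance G R" and Rij: "R i j \<ge> 0"
    and \<phi>: "\<And>x y. x \<in> V \<Longrightarrow> y \<in> V \<Longrightarrow> 2 * (\<phi> x - \<phi> y) = R x j - R x i - R y j + R y i"
begin

text \<open>\<open>\<phi>\<close> is the potential of a unit current from \<open>i\<close> to \<open>j\<close>, so this is the rank-one
  (Sherman--Morrison) update of the resistances.\<close>

lemma resistance_add_edge:
  "resistance (add_edge i j G) (\<lambda>x y. R x y - (\<phi> x - \<phi> y)\<^sup>2 / (1 + R i j))"
proof -
  from R obtain c where c: "\<And>x y. x \<in> V \<Longrightarrow> y \<in> V \<Longrightarrow>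
      (\<Sum>z\<in>N x. R x y - R z y) = c x - (if x = y then 2 else 0)"
    unfolding resistance_def by blast
  have R0: "R x x = 0" if "x \<in> V" for x using R that by (simp add: resistance_def)
  have Rsym: "R x y = R y x" if "x \<in> V" "y \<in> V" for x y using R that by (simp add: resistance_def)
  define r where "r = R i j"
  have r: "1 + r > 0" using Rij by (simp add: r_def)
  have phi_j: "\<phi> j = \<phi> i - r"
    using \<phi>[of i j] ij Rsym[of i j] by (simp add: R0 r_def)
  define K where "K x = (\<Sum>z\<in>N x. (\<phi> x)\<^sup>2 - (\<phi> z)\<^sup>2)" for x
  \<comment> \<open>Kirchhoff's law for the current: \<open>2 * \<phi>\<close> is, up to a constant,
    the difference of two columns of \<open>R\<close>, so \<open>c\<close> cancels and only the
    sources remain.\<close>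
  have lap_\<phi>: "(\<Sum>z\<in>N x. \<phi> x - \<phi> z) = (if x = i then 1 else 0) - (if x = j then 1 else 0)"
    if x: "x \<in> V" for x
  proof -
    have "2 * (\<Sum>z\<in>N x. \<phi> x - \<phi> z) = (\<Sum>z\<in>N x. (R x j - R z j) - (R x i - R z i))"
      unfolding sum_distrib_left
    proof (intro sum.cong refl)
      fix z assume "z \<in> N x"
      then have "z \<in> V" using nbrs_subset by blast
      then show "2 * (\<phi> x - \<phi> z) = (R x j - R z j) - (R x i - R z i)" using \<phi>[OF x, of z] by simp
    qed
    also have "\<dots> = (c x - (if x = j then 2 else 0)) - (c x - (if x = i then 2 else 0))"
      by (simp only: sum_subtractf[of "\<lambda>z. R x j - R z j"] c x ij)
    finally show ?thesis by (simp split: if_splits)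
  qed
  \<comment> \<open>At \<open>x = i\<close> and \<open>x = j\<close> the terms in
    \<open>\<phi> y\<close> from the old neighbours cancel against those from the new edge; what is
    left depends on \<open>x\<close> alone.\<close>
  define c' where "c' x = c x - K x / (1 + r) + (if x = i then (2 * \<phi> i - r) / (1 + r) else 0)
      - (if x = j then (2 * \<phi> i - r) / (1 + r) else 0)" for x
  have "(\<Sum>z\<in>nbrs (add_edge i j G) x. (R x y - (\<phi> x - \<phi> y)\<^sup>2 / (1 + r)) - (R z y - (\<phi> z - \<phi> y)\<^sup>2 / (1 + r)))
      = c' x - (if x = y then 2 else 0)" if x: "x \<in> V" and y: "y \<in> V" for x y
  proof -
    let ?E = "\<lambda>z. R z y - (\<phi> z - \<phi> y)\<^sup>2 / (1 + r)"
    have "(\<Sum>z\<in>N x. ?E x - ?E z) = (\<Sum>z\<in>N x. (R x y - R z y) -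
        (1 / (1 + r) * ((\<phi> x)\<^sup>2 - (\<phi> z)\<^sup>2) - 2 * \<phi> y / (1 + r) * (\<phi> x - \<phi> z)))"
      by (intro sum.cong refl)
        (simp add: power2_eq_square algebra_simps diff_divide_distrib add_divide_distrib)
    also have "\<dots> = c x - (if x = y then 2 else 0) - (1 / (1 + r) * K x - 2 * \<phi> y / (1 + r) *
        ((if x = i then 1 else 0) - (if x = j then 1 else 0)))"
      unfolding lap_\<phi>[OF x, symmetric] c[OF x y, symmetric] K_def
      by (simp only: sum_subtractf[of "\<lambda>z. R x y - R z y"] sum_distrib_left
          sum_subtractf[of "\<lambda>z. 1 / (1 + r) * ((\<phi> x)\<^sup>2 - (\<phi> z)\<^sup>2)"])
    finally have old: "(\<Sum>z\<in>N x. ?E x - ?E z) = c x - (if x = y then 2 else 0)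
        - (1 / (1 + r) * K x - 2 * \<phi> y / (1 + r) * ((if x = i then 1 else 0) - (if x = j then 1 else 0)))" .
    have Rjy: "R j y = R i y - (2 * (\<phi> i - \<phi> y) - r)"
      using \<phi>[OF y ij(1)] Rsym[OF y ij(1)] Rsym[OF y ij(2)] R0[OF ij(1)] by (simp add: r_def)
    \<comment> \<open>With \<open>A = 2 * (\<phi> i - \<phi> y) - r\<close>, the change in
      \<open>R\<close> is \<open>A\<close> and the change in the square is \<open>r * A\<close>, so
      the difference is \<open>A - r * A / (1 + r)\<close>.\<close>
    have new: "?E i - ?E j = (2 * (\<phi> i - \<phi> y) - r) / (1 + r)"
    proof -
      have sq: "(\<phi> i - \<phi> y)\<^sup>2 = (\<phi> i - r - \<phi> y)\<^sup>2 + r * (2 * (\<phi> i - \<phi> y) - r)"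
        by (simp add: algebra_simps power2_eq_square)
      have "1 + r \<noteq> 0" using r by simp
      then show ?thesis
        unfolding Rjy phi_j sq add_divide_distrib by (simp add: divide_simps) (simp add: algebra_simps)
    qed
    then have new': "?E j - ?E i = - ((2 * (\<phi> i - \<phi> y) - r) / (1 + r))" by simp
    show ?thesis
      unfolding sum_nbrs_add_edge old
      using ij(3) new new' r by (auto simp: c'_def diff_divide_distrib add_divide_distrib right_diff_distrib)
  qed
  then show ?thesis
    unfolding resistance_def verts_add_edge r_def[symmetric]
    using R0 Rsym by (auto simp: power2_commute)
qed

text \<open>\<open>P\<close> and \<open>Q\<close> are the first and second moments of
  \<open>\<phi>\<close> for the new degrees, whose total is \<open>vol + 2\<close>. Hence the double
  sum of \<open>(\<phi> y - \<phi> z)\<^sup>2\<close> is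
  \<open>2 * ((vol + 2) * Q - P\<^sup>2)\<close>.\<close>

theorem kemeny_add_edge:
  defines "P \<equiv> (\<Sum>x\<in>V. d x * \<phi> x) + \<phi> i + \<phi> j"
    and "Q \<equiv> (\<Sum>x\<in>V. d x * (\<phi> x)\<^sup>2) + (\<phi> i)\<^sup>2 + (\<phi> j)\<^sup>2"
  shows "kemeny (add_edge i j G) =
    ((\<Sum>y\<in>V. d y * (\<Sum>z\<in>V. d z * R y z)) + 2 * (\<Sum>z\<in>V. d z * R i z) + 2 * (\<Sum>z\<in>V. d z * R j z)
      + 2 * R i j - 2 * ((vol + 2) * Q - P\<^sup>2) / (1 + R i j)) / (2 * (vol + 2))"
proof -
  interpret H: connected_graph "add_edge i j G" by (rule connected_graph_add_edge)
  have R0: "R x x = 0" if "x \<in> V" for x using R that by (simp add: resistance_def)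
  have Rsym: "R x y = R y x" if "x \<in> V" "y \<in> V" for x y using R that by (simp add: resistance_def)
  define r where "r = R i j"
  have r: "1 + r > 0" using Rij by (simp add: r_def)
  \<comment> \<open>Treating the degree-weighted sum as a linear functional reduces the expansion of
    the double sum to the rules \<open>D_diff\<close>, \<open>D_add\<close>, \<open>D_cmult\<close>
    and \<open>D_const\<close>.\<close>
  define D where "D f = (\<Sum>x\<in>V. deg (add_edge i j G) x * f x)" for f
  have D: "D f = (\<Sum>x\<in>V. d x * f x) + f i + f j" for f
    unfolding D_def by (rule sum_deg_add_edge)
  have D_diff: "D (\<lambda>x. f x - g x) = D f - D g" for f g
    by (simp add: D_def right_diff_distrib sum_subtractf)
  have D_add: "D (\<lambda>x. f x + g x) = D f + D g" for f g
    by (simp add: D_def distrib_left sum.distrib)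
  have D_cmult: "D (\<lambda>x. k * f x) = k * D f" for f k
    by (simp add: D_def sum_distrib_left mult.left_commute)
  have D_const: "D (\<lambda>x. k) = (vol + 2) * k" for k
    unfolding D by (simp add: vol_def sum_distrib_right distrib_right)
  have P: "D \<phi> = P" and Q: "D (\<lambda>x. (\<phi> x)\<^sup>2) = Q" by (simp_all add: D P_def Q_def)
  have vol: "H.vol = vol + 2"
    using D_const[of 1] by (simp add: D_def H.vol_def verts_add_edge)
  have "kemeny (add_edge i j G) = D (\<lambda>y. D (\<lambda>z. R y z - (\<phi> y - \<phi> z)\<^sup>2 / (1 + r))) / (2 * (vol + 2))"
    using H.kemeny_resistance[OF resistance_add_edge]
    unfolding vol verts_add_edge r_def[symmetric] D_def .
  also have "D (\<lambda>y. D (\<lambda>z. R y z - (\<phi> y - \<phi> z)\<^sup>2 / (1 + r))) =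
      D (\<lambda>y. D (R y) - 1 / (1 + r) * ((vol + 2) * (\<phi> y)\<^sup>2 - (2 * P) * \<phi> y + Q))"
  proof -
    have "(\<lambda>z. R y z - (\<phi> y - \<phi> z)\<^sup>2 / (1 + r)) =
        (\<lambda>z. R y z - 1 / (1 + r) * ((\<phi> y)\<^sup>2 - (2 * \<phi> y) * \<phi> z + (\<phi> z)\<^sup>2))" for y
      by (simp add: power2_eq_square algebra_simps diff_divide_distrib add_divide_distrib)
    then have "D (\<lambda>z. R y z - (\<phi> y - \<phi> z)\<^sup>2 / (1 + r)) =
        D (R y) - 1 / (1 + r) * ((vol + 2) * (\<phi> y)\<^sup>2 - (2 * P) * \<phi> y + Q)" for y
      by (simp only: D_diff D_add D_cmult D_const P Q) (simp only: mult_ac)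
    then show ?thesis by simp
  qed
  also have "\<dots> = D (\<lambda>y. D (R y)) - 1 / (1 + r) * ((vol + 2) * Q - 2 * P * P + (vol + 2) * Q)"
    by (simp only: D_diff D_add D_cmult D_const P Q)
  also have "D (\<lambda>y. D (R y)) = (\<Sum>y\<in>V. d y * (\<Sum>z\<in>V. d z * R y z))
      + 2 * (\<Sum>z\<in>V. d z * R i z) + 2 * (\<Sum>z\<in>V. d z * R j z) + 2 * r"
  proof -
    have "(\<Sum>x\<in>V. d x * R x k) = (\<Sum>z\<in>V. d z * R k z)" if "k \<in> V" for k
      using Rsym[OF _ that] by (intro sum.cong refl) simp
    then show ?thesis
      using ij R0 Rsym[of j i] by (simp add: D distrib_left sum.distrib r_def)
  qed
  finally show ?thesis
    unfolding r_def[symmetric]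
    by (simp add: power2_eq_square algebra_simps diff_divide_distrib add_divide_distrib)
qed

end
end
end

subsection \<open>Spiders\<close>

fun spider_dist :: "spider_vertex \<Rightarrow> spider_vertex \<Rightarrow> real" where
  "spider_dist Center Center = 0"
| "spider_dist Center (Leg m e) = real e"
| "spider_dist (Leg l k) Center = real k"
| "spider_dist (Leg l k) (Leg m e) = (if l = m then \<bar>real k - real e\<bar> else real k + real e)"

lemma spider_dist_on_leg:
  "spider_dist (on_leg l k) (on_leg m e) = (if l = m then \<bar>real k - real e\<bar> else real k + real e)"
  by (simp add: on_leg_def)

lemma verts_spider: "verts (spider a b) = {on_leg l k | l k. l < b \<and> k \<le> a}"
  by (simp add: spider_def)

lemma on_leg_in_verts: "l < b \<Longrightarrow> k \<le> a \<Longrightarrow> on_leg l k \<in> verts (spider a b)"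
  by (auto simp: verts_spider)

lemma on_leg_0 [simp]: "on_leg l 0 = Center"
  by (simp add: on_leg_def)

lemma on_leg_Suc [simp]: "on_leg l (Suc k) = Leg l (Suc k)"
  by (simp add: on_leg_def)

lemma edge_spider_iff:
  "{x, y} \<in> edges (spider a b) \<longleftrightarrow> (\<exists>l k. l < b \<and> k < a \<and>
    (x = on_leg l k \<and> y = on_leg l (Suc k) \<or> x = on_leg l (Suc k) \<and> y = on_leg l k))"
  by (auto simp: spider_def doubleton_eq_iff)

lemma nbrs_spider_Center:
  assumes "1 \<le> a"
  shows "nbrs (spider a b) Center = (\<lambda>l. Leg l 1) ` {..<b}"
  using assms by (force simp: nbrs_def edge_spider_iff on_leg_def)

lemma nbrs_spider_Leg:
  assumes "l < b" "k < a"
  shows "nbrs (spider a b) (Leg l (Suc k)) =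
    insert (on_leg l k) (if Suc k < a then {Leg l (Suc (Suc k))} else {})"
  using assms by (auto simp: nbrs_def edge_spider_iff on_leg_def split: if_splits)

lemma sum_nbrs_spider_Center:
  assumes "1 \<le> a"
  shows "(\<Sum>z\<in>nbrs (spider a b) Center. f z) = (\<Sum>l<b. f (Leg l 1))"
  unfolding nbrs_spider_Center[OF assms] by (subst sum.reindex) (auto simp: inj_on_def)

lemma sum_nbrs_spider_Leg:
  assumes "l < b" "k < a"
  shows "(\<Sum>z\<in>nbrs (spider a b) (Leg l (Suc k)). f z) =
    f (on_leg l k) + (if Suc k < a then f (Leg l (Suc (Suc k))) else 0)"
  unfolding nbrs_spider_Leg[OF assms] by (auto simp: on_leg_def)

lemma deg_spider_Center: "1 \<le> a \<Longrightarrow> deg (spider a b) Center = real b"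
  using sum_nbrs_spider_Center[of a "\<lambda>_. 1 :: real" b] by (simp add: deg_def)

lemma deg_spider_Leg:
  "l < b \<Longrightarrow> k < a \<Longrightarrow> deg (spider a b) (Leg l (Suc k)) = (if Suc k < a then 2 else 1)"
  using sum_nbrs_spider_Leg[of l b k a "\<lambda>_. 1 :: real"] by (simp add: deg_def)

lemma verts_spider_eq:
  assumes "1 \<le> b"
  shows "verts (spider a b) = insert Center ((\<lambda>(l, k). Leg l (Suc k)) ` ({..<b} \<times> {..<a}))"
proof (intro set_eqI iffI)
  fix x assume "x \<in> verts (spider a b)"
  then obtain l k where "x = on_leg l k" "l < b" "k \<le> a" by (auto simp: verts_spider)
  then show "x \<in> insert Center ((\<lambda>(l, k). Leg l (Suc k)) ` ({..<b} \<times> {..<a}))"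
    by (cases k) auto
next
  fix x assume "x \<in> insert Center ((\<lambda>(l, k). Leg l (Suc k)) ` ({..<b} \<times> {..<a}))"
  then consider "x = on_leg 0 0" | l k where "x = on_leg l (Suc k)" "l < b" "k < a" by auto
  then show "x \<in> verts (spider a b)"
    using assms by cases (simp_all only: on_leg_in_verts Suc_le_eq)
qed

lemma sum_verts_spider:
  assumes "1 \<le> b"
  shows "(\<Sum>x\<in>verts (spider a b). f x) = f Center + (\<Sum>l<b. \<Sum>k<a. f (Leg l (Suc k)))"
proof -
  have "(\<Sum>x\<in>verts (spider a b). f x) =
      f Center + (\<Sum>x\<in>(\<lambda>(l, k). Leg l (Suc k)) ` ({..<b} \<times> {..<a}). f x)"
    unfolding verts_spider_eq[OF assms] by (subst sum.insert) auto
  also have "(\<Sum>x\<in>(\<lambda>(l, k). Leg l (Suc k)) ` ({..<b} \<times> {..<a}). f x) =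
      (\<Sum>(l, k)\<in>{..<b} \<times> {..<a}. f (Leg l (Suc k)))"
    by (subst sum.reindex) (auto simp: inj_on_def case_prod_beta)
  finally show ?thesis by (simp add: sum.cartesian_product)
qed

text \<open>Handshake principle: weighting vertices by degree amounts to summing \<open>f\<close>
  over both ends of every edge. This removes the case distinction on degrees from all later
  sums.\<close>

lemma sum_deg_spider:
  assumes "1 \<le> a" "1 \<le> b"
  shows "(\<Sum>x\<in>verts (spider a b). deg (spider a b) x * f x) =
    (\<Sum>l<b. \<Sum>k<a. f (on_leg l k) + f (on_leg l (Suc k)))"
proof -
  obtain a' where a': "a = Suc a'" using assms(1) by (cases a) auto
  have leg: "(\<Sum>k<a. f (on_leg l k) + f (on_leg l (Suc k))) =
      f Center + (\<Sum>k<a. deg (spider a b) (Leg l (Suc k)) * f (Leg l (Suc k)))" if "l < b" for l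
  proof -
    have "(\<Sum>k<a. deg (spider a b) (Leg l (Suc k)) * f (Leg l (Suc k))) =
        (\<Sum>k<a. (if Suc k < a then 2 else 1) * f (Leg l (Suc k)))"
      using that by (intro sum.cong refl) (simp add: deg_spider_Leg)
    also have "\<dots> = (\<Sum>k<a'. 2 * f (Leg l (Suc k))) + f (Leg l a)"
      unfolding a' by simp
    also have "f Center + \<dots> = (\<Sum>k<a. f (on_leg l k)) + (\<Sum>k<a. f (on_leg l (Suc k)))"
    proof -
      have "(\<Sum>k<a. f (on_leg l k)) = f Center + (\<Sum>k<a'. f (Leg l (Suc k)))"
        unfolding a' by (subst sum.lessThan_Suc_shift) simp
      moreover have "(\<Sum>k<a. f (on_leg l (Suc k))) = (\<Sum>k<a'. f (Leg l (Suc k))) + f (Leg l a)"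
        unfolding a' by simp
      ultimately show ?thesis by (simp add: sum_distrib_left[symmetric])
    qed
    finally show ?thesis by (simp add: sum.distrib)
  qed
  have "(\<Sum>l<b. \<Sum>k<a. f (on_leg l k) + f (on_leg l (Suc k))) =
      (\<Sum>l<b. f Center + (\<Sum>k<a. deg (spider a b) (Leg l (Suc k)) * f (Leg l (Suc k))))"
    by (intro sum.cong refl leg) simp
  then show ?thesis
    by (simp add: sum_verts_spider[OF assms(2)] deg_spider_Center[OF assms(1)] sum.distrib)
qed

lemma connected_graph_spider:
  assumes "1 \<le> a" "1 \<le> b"
  shows "connected_graph (spider a b)"
proof
  let ?E = "{(u, v). {u, v} \<in> edges (spider a b)}"
  have sym: "sym ?E" by (auto simp: sym_def insert_commute)
  show "finite (verts (spider a b))" by (simp add: verts_spider_eq[OF assms(2)])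
  show "\<exists>x\<in>verts (spider a b). \<exists>y\<in>verts (spider a b). x \<noteq> y"
    unfolding verts_spider_eq[OF assms(2)] using assms by (intro bexI[of _ Center] bexI[of _ "Leg 0 1"]) force+
  show "x \<in> verts (spider a b) \<and> x \<noteq> y" if xy: "{x, y} \<in> edges (spider a b)" for x y
  proof -
    obtain l k where "l < b" "k < a"
      "x = on_leg l k \<and> y = on_leg l (Suc k) \<or> x = on_leg l (Suc k) \<and> y = on_leg l k"
      using xy by (auto simp: edge_spider_iff)
    moreover have "on_leg l k \<noteq> on_leg l (Suc k)" by (simp add: on_leg_def)
    ultimately show ?thesis
      using on_leg_in_verts[of l b k a] on_leg_in_verts[of l b "Suc k" a] by auto
  qed
  have to_Center: "(on_leg l k, Center) \<in> ?E\<^sup>*" if "l < b" "k \<le> a" for l k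
    using that(2)
  proof (induction k)
    case (Suc k)
    then have "{on_leg l (Suc k), on_leg l k} \<in> edges (spider a b)"
      unfolding edge_spider_iff using that(1) by (intro exI[of _ l] exI[of _ k]) simp
    then have "(on_leg l (Suc k), on_leg l k) \<in> ?E" by blast
    then show ?case using Suc by (meson Suc_leD converse_rtrancl_into_rtrancl)
  qed simp
  show "(x, y) \<in> ?E\<^sup>*" if "x \<in> verts (spider a b)" "y \<in> verts (spider a b)" for x y
  proof -
    have x: "(x, Center) \<in> ?E\<^sup>*" and y: "(y, Center) \<in> ?E\<^sup>*"
      using that to_Center by (auto simp: verts_spider)
    have "(Center, y) \<in> ?E\<^sup>*" using y sym_rtrancl[OF sym] by (auto dest: symD)
    with x show ?thesis by (rule rtrancl_trans)
  qed
qed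

text \<open>Exactly one neighbour of \<open>x \<noteq> y\<close> is closer to \<open>y\<close> and
  all others are farther, so the sum is \<open>1 - (deg - 1) = 2 - deg\<close>; at
  \<open>x = y\<close> all neighbours are farther and the sum is \<open>- deg\<close>.\<close>

lemma resistance_spider:
  assumes "1 \<le> a" "1 \<le> b"
  shows "resistance (spider a b) spider_dist"
  unfolding resistance_def
proof (intro conjI ballI exI)
  fix x
  show "spider_dist x x = 0" by (cases x) auto
  fix y
  show "spider_dist x y = spider_dist y x" by (cases x; cases y) auto
next
  let ?G = "spider a b"
  fix x y assume x: "x \<in> verts ?G" and y: "y \<in> verts ?G"
  obtain m e where y': "y = on_leg m e" "m < b" "e \<le> a" using y by (auto simp: verts_spider)
  show "(\<Sum>z\<in>nbrs ?G x. spider_dist x y - spider_dist z y) = 2 - deg ?G x - (if x = y then 2 else 0)"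
  proof (cases x)
    case Center
    \<comment> \<open>Only leg \<open>m\<close> leads towards \<open>y\<close>, and none does if
      \<open>e = 0\<close>, that is, if \<open>y\<close> is the center.\<close>
    have "(\<Sum>l<b. spider_dist Center y - spider_dist (Leg l 1) y) =
        (\<Sum>l<b. (if l = m then (if e = 0 then 0 else 2) else 0) - 1)"
    proof (intro sum.cong refl)
      fix l
      have "spider_dist (on_leg l 0) y - spider_dist (on_leg l (Suc 0)) y =
          (if l = m then (if e = 0 then 0 else 2) else 0) - 1"
        unfolding y' spider_dist_on_leg by auto
      then show "spider_dist Center y - spider_dist (Leg l 1) y =
          (if l = m then (if e = 0 then 0 else 2) else 0) - 1" by simp
    qed
    also have "\<dots> = (if e = 0 then 0 else 2) - real b"
      using y'(2) by (simp add: sum_subtractf)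
    finally show ?thesis
      unfolding Center sum_nbrs_spider_Center[OF assms(1)] deg_spider_Center[OF assms(1)]
      by (simp add: y' on_leg_def)
  next
    case (Leg l k')
    then obtain k where x': "x = Leg l (Suc k)" "l < b" "k < a"
      using x by (auto simp: verts_spider_eq[OF assms(2)])
    have "spider_dist (on_leg l (Suc k)) y - spider_dist (on_leg l k) y +
        (if Suc k < a then spider_dist (on_leg l (Suc k)) y - spider_dist (on_leg l (Suc (Suc k))) y else 0) =
        2 - (if Suc k < a then 2 else 1) - (if l = m \<and> Suc k = e then 2 else 0)"
      unfolding y' spider_dist_on_leg using y'(3) x'(3)
      by (cases "e \<le> k"; cases "Suc k = e") auto
    moreover have "x = y \<longleftrightarrow> l = m \<and> Suc k = e" by (auto simp: x' y' on_leg_def)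
    ultimately show ?thesis
      unfolding x'(1) sum_nbrs_spider_Leg[OF x'(2,3)] deg_spider_Leg[OF x'(2,3)]
      by (auto split: if_splits)
  qed
qed

section \<open>Closed forms of sums along a leg\<close>

text \<open>The signed square \<open>(n - t) * \<bar>n - t\<bar>\<close> gives one formula on both
  sides of \<open>t\<close>, so the induction can start at 0.\<close>

lemma sum_abs_consecutive:
  "(\<Sum>k<n. \<bar>real t - real k\<bar> + \<bar>real t - real (Suc k)\<bar>) = (real t)\<^sup>2 + (real n - real t) * \<bar>real n - real t\<bar>"
proof (induction n)
  case (Suc n)
  have "\<bar>real t - real n\<bar> + \<bar>real t - real (Suc n)\<bar> + (real n - real t) * \<bar>real n - real t\<bar> =
      (real (Suc n) - real t) * \<bar>real (Suc n) - real t\<bar>"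
    by (cases "t \<le> n") (auto simp: algebra_simps)
  then show ?case using Suc by simp
qed (simp add: power2_eq_square)

lemma sum_odd_shift: "(\<Sum>k<n. (x + real k) + (x + real (Suc k))) = 2 * real n * x + (real n)\<^sup>2"
  by (induction n) (simp_all add: power2_eq_square algebra_simps)

text \<open>From \<open>s\<close> on the summands are constant, so the induction starts at
  \<open>n = s\<close>, where the truncation disappears.\<close>

lemma sum_min_consecutive:
  assumes "s \<le> n"
  shows "(\<Sum>k<n. real (min k s) + real (min (Suc k) s)) = 2 * real n * real s - (real s)\<^sup>2"
  using assms
proof (induction n rule: dec_induct)
  case base
  have "(\<Sum>k<s. real (min k s) + real (min (Suc k) s)) = (\<Sum>k<s. (0 + real k) + (0 + real (Suc k)))"
    by (intro sum.cong refl) simp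
  then show ?case unfolding sum_odd_shift by (simp add: power2_eq_square)
next
  case (step n)
  then show ?case by (simp add: algebra_simps)
qed

lemma sum_min_sq_consecutive:
  assumes "s \<le> n"
  shows "(\<Sum>k<n. (real (min k s))\<^sup>2 + (real (min (Suc k) s))\<^sup>2) =
    2 * real n * (real s)\<^sup>2 - 4 / 3 * (real s)^3 + real s / 3"
  using assms
proof (induction n rule: dec_induct)
  case base
  have "(\<Sum>k<s. (real (min k s))\<^sup>2 + (real (min (Suc k) s))\<^sup>2) = (\<Sum>k<s. (real k)\<^sup>2 + (real (Suc k))\<^sup>2)"
    by (intro sum.cong refl) simp
  also have "\<dots> = (2 * (real s)^3 + real s) / 3"
    by (induction s) (simp_all add: power2_eq_square power3_eq_cube field_simps)
  finally show ?case by (simp add: power2_eq_square power3_eq_cube field_simps)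
next
  case (step n)
  then show ?case by (simp add: algebra_simps)
qed

lemma sum_if_eq:
  assumes "m < b"
  shows "(\<Sum>l<b. if l = m then x else y) = x + (real b - 1) * (y :: real)"
proof -
  have "(\<Sum>l<b. if l = m then x else y) = (\<Sum>l<b. y + (if l = m then x - y else 0))"
    by (intro sum.cong refl) simp
  then show ?thesis using assms by (simp add: sum.distrib algebra_simps)
qed

lemma sum_if_eq2:
  fixes b m m' :: nat
  assumes "m < b" "m' < b" "m \<noteq> m'"
  shows "(\<Sum>l<b. if l = m then x else if l = m' then y else 0) = x + (y :: real)"
proof -
  have "(\<Sum>l<b. if l = m then x else if l = m' then y else 0) =
      (\<Sum>l<b. (if l = m then x else 0) + (if l = m' then y else 0))"
    using assms by (intro sum.cong refl) simp
  then show ?thesis using assms by (simp add: sum.distrib)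
qed

lemma sum_deg_spider_dist:
  assumes "1 \<le> a" "m < b" "t \<le> a"
  shows "(\<Sum>z\<in>verts (spider a b). deg (spider a b) z * spider_dist (on_leg m t) z) =
    real b * (real a)\<^sup>2 + 2 * real a * (real b - 2) * real t + 2 * (real t)\<^sup>2"
proof -
  \<comment> \<open>The leg containing the vertex is split by it into pieces of lengths
    \<open>t\<close> and \<open>a - t\<close>; every other leg is seen through the center at offset
    \<open>t\<close>.\<close>
  have "(\<Sum>k<a. spider_dist (on_leg m t) (on_leg l k) + spider_dist (on_leg m t) (on_leg l (Suc k))) =
      (if l = m then (real t)\<^sup>2 + (real a - real t)\<^sup>2 else 2 * real a * real t + (real a)\<^sup>2)" for l
  proof (cases "l = m")
    case True
    then show ?thesis
      using sum_abs_consecutive[of t a] assms(3)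
      by (simp only: spider_dist_on_leg) (simp add: power2_eq_square)
  next
    case False
    then show ?thesis
      using sum_odd_shift[of "real t" a] by (simp only: spider_dist_on_leg) simp
  qed
  then have "(\<Sum>z\<in>verts (spider a b). deg (spider a b) z * spider_dist (on_leg m t) z) =
      (\<Sum>l<b. if l = m then (real t)\<^sup>2 + (real a - real t)\<^sup>2 else 2 * real a * real t + (real a)\<^sup>2)"
    using assms by (subst sum_deg_spider) auto
  then show ?thesis
    unfolding sum_if_eq[OF assms(2)] by (simp add: power2_eq_square algebra_simps)
qed

lemma sum_deg_deg_spider_dist:
  assumes "1 \<le> a" "1 \<le> b"
  shows "(\<Sum>y\<in>verts (spider a b). deg (spider a b) y *
      (\<Sum>z\<in>verts (spider a b). deg (spider a b) z * spider_dist y z)) =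
    real b * (4 * (real a)^3 * real b - 8 / 3 * (real a)^3 + 2 / 3 * real a)"
proof -
  let ?S = "\<lambda>t. real b * (real a)\<^sup>2 + 2 * real a * (real b - 2) * real t + 2 * (real t)\<^sup>2"
  have poly: "(\<Sum>k<n. (u + v * real k + 2 * (real k)\<^sup>2) + (u + v * real (Suc k) + 2 * (real (Suc k))\<^sup>2)) =
      2 * u * n + v * (real n)\<^sup>2 + (4 * (real n)^3 + 2 * real n) / 3" for n and u v :: real
    by (induction n) (simp_all add: power2_eq_square power3_eq_cube field_simps)
  have "(\<Sum>y\<in>verts (spider a b). deg (spider a b) y *
      (\<Sum>z\<in>verts (spider a b). deg (spider a b) z * spider_dist y z)) =
      (\<Sum>l<b. \<Sum>k<a. ?S k + ?S (Suc k))"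
    unfolding sum_deg_spider[OF assms, where f = "\<lambda>y. \<Sum>z\<in>verts (spider a b). deg (spider a b) z * spider_dist y z"]
    using assms(1) by (intro sum.cong refl arg_cong2[where f = "(+)"] sum_deg_spider_dist) auto
  also have "\<dots> = real b * (2 * (real b * (real a)\<^sup>2) * a + 2 * real a * (real b - 2) * (real a)\<^sup>2
      + (4 * (real a)^3 + 2 * real a) / 3)"
    unfolding poly by simp
  also have "\<dots> = real b * (4 * (real a)^3 * real b - 8 / 3 * (real a)^3 + 2 / 3 * real a)"
    by (simp add: power2_eq_square power3_eq_cube field_simps)
  finally show ?thesis .
qed

lemma vol_spider:
  assumes "1 \<le> a" "1 \<le> b"
  shows "connected_graph.vol (spider a b) = 2 * real a * real b"
  unfolding connected_graph.vol_def[OF connected_graph_spider[OF assms]]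
  using sum_deg_spider[OF assms, of "\<lambda>_. 1"] by simp

lemma kemeny_spider:
  assumes "1 \<le> a" "1 \<le> b"
  shows "kemeny (spider a b) = real b * (real a)\<^sup>2 - 2 / 3 * (real a)\<^sup>2 + 1 / 6"
proof -
  interpret connected_graph "spider a b" by (rule connected_graph_spider[OF assms])
  show ?thesis
    unfolding kemeny_resistance[OF resistance_spider[OF assms]] sum_deg_deg_spider_dist[OF assms]
      vol_spider[OF assms]
    using assms by (simp add: field_simps power2_eq_square power3_eq_cube)
qed

section \<open>The spider with an added edge\<close>

context
  fixes a b m m' s t :: nat
  assumes ab: "1 \<le> a" "1 \<le> b" and m: "m < b" "m' < b" "m \<noteq> m'"
    and st: "s \<le> a" "t \<le> a" "2 \<le> s + t"
begin

lemma kemeny_spider_add_edge: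
  defines "P \<equiv> (real s - real t) * (2 * real a + 1 - real s - real t)"
    and "Q \<equiv> (2 * real a + 1) * ((real s)\<^sup>2 + (real t)\<^sup>2) - 4 / 3 * ((real s)^3 + (real t)^3) + (real s + real t) / 3"
    and "r \<equiv> real s + real t"
  shows "kemeny (add_edge (on_leg m s) (on_leg m' t) (spider a b)) =
    (4 * real a * real b * kemeny (spider a b)
      + 2 * (2 * real b * (real a)\<^sup>2 + 2 * real a * (real b - 2) * r + 2 * ((real s)\<^sup>2 + (real t)\<^sup>2))
      + 2 * r - 2 * ((2 * real a * real b + 2) * Q - P\<^sup>2) / (1 + r)) / (2 * (2 * real a * real b + 2))"
proof -
  let ?i = "on_leg m s" and ?j = "on_leg m' t" and ?G = "spider a b"
  interpret connected_graph ?G by (rule connected_graph_spider[OF ab])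
  \<comment> \<open>The additive constant is chosen so that \<open>\<phi> Center = 0\<close>; then
    all legs other than \<open>m\<close> and \<open>m'\<close> drop out of the moments.\<close>
  define \<phi> where "\<phi> x = (spider_dist x ?j - spider_dist x ?i + real s - real t) / 2" for x
  have r: "spider_dist ?i ?j = r" using m(3) by (simp add: spider_dist_on_leg r_def)
  have verts: "?i \<in> V" "?j \<in> V" using m st by (auto intro: on_leg_in_verts)
  have dist_edge: "spider_dist x y = 1" if xy: "{x, y} \<in> edges ?G" for x y
  proof -
    obtain l k where "x = on_leg l k \<and> y = on_leg l (Suc k) \<or> x = on_leg l (Suc k) \<and> y = on_leg l k"
      using xy unfolding edge_spider_iff by blast
    then show ?thesis by (elim disjE conjE) (simp_all only: spider_dist_on_leg, simp_all)
  qed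
  have r2: "r \<ge> 2" using st(3) by (simp add: r_def)
  have nonadj: "{?i, ?j} \<notin> edges ?G" using dist_edge[of ?i ?j] r r2 by auto
  have neq: "?i \<noteq> ?j" using r r2 m(3) st(3) by (auto simp: on_leg_def split: if_splits)
  have \<phi>_leg: "\<phi> (on_leg l k) = (if l = m then real (min k s) else if l = m' then - real (min k t) else 0)" for l k
    unfolding \<phi>_def spider_dist_on_leg using m(3) by (auto simp: min_def)
  have sum_\<phi>: "(\<Sum>x\<in>V. d x * \<phi> x) = (2 * real a * real s - (real s)\<^sup>2) - (2 * real a * real t - (real t)\<^sup>2)"
  proof -
    have "(\<Sum>x\<in>V. d x * \<phi> x) = (\<Sum>l<b. if l = m then (\<Sum>k<a. real (min k s) + real (min (Suc k) s))
        else if l = m' then - (\<Sum>k<a. real (min k t) + real (min (Suc k) t)) else 0)"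
      unfolding sum_deg_spider[OF ab] \<phi>_leg
      by (intro sum.cong refl) (simp add: sum_negf[symmetric])
    then show ?thesis unfolding sum_if_eq2[OF m] using st by (simp add: sum_min_consecutive)
  qed
  have sum_\<phi>2: "(\<Sum>x\<in>V. d x * (\<phi> x)\<^sup>2) = (2 * real a * (real s)\<^sup>2 - 4 / 3 * (real s)^3 + real s / 3)
      + (2 * real a * (real t)\<^sup>2 - 4 / 3 * (real t)^3 + real t / 3)"
  proof -
    have "(\<Sum>x\<in>V. d x * (\<phi> x)\<^sup>2) =
        (\<Sum>l<b. if l = m then (\<Sum>k<a. (real (min k s))\<^sup>2 + (real (min (Suc k) s))\<^sup>2)
        else if l = m' then (\<Sum>k<a. (real (min k t))\<^sup>2 + (real (min (Suc k) t))\<^sup>2) else 0)"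
      unfolding sum_deg_spider[OF ab] \<phi>_leg by (intro sum.cong refl) simp
    then show ?thesis unfolding sum_if_eq2[OF m] using st by (simp add: sum_min_sq_consecutive)
  qed
  have P: "(\<Sum>x\<in>V. d x * \<phi> x) + \<phi> ?i + \<phi> ?j = P"
    unfolding sum_\<phi> \<phi>_leg P_def using m(3) by (simp add: power2_eq_square algebra_simps)
  have Q: "(\<Sum>x\<in>V. d x * (\<phi> x)\<^sup>2) + (\<phi> ?i)\<^sup>2 + (\<phi> ?j)\<^sup>2 = Q"
    unfolding sum_\<phi>2 \<phi>_leg Q_def using m(3) by (simp add: algebra_simps add_divide_distrib)
  have J: "(\<Sum>y\<in>V. d y * (\<Sum>z\<in>V. d z * spider_dist y z)) = 4 * real a * real b * kemeny ?G"
    unfolding sum_deg_deg_spider_dist[OF ab] kemeny_spider[OF ab]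
    by (simp add: power2_eq_square power3_eq_cube field_simps)
  have "kemeny (add_edge ?i ?j ?G) = (4 * real a * real b * kemeny ?G
      + 2 * (\<Sum>z\<in>V. d z * spider_dist ?i z) + 2 * (\<Sum>z\<in>V. d z * spider_dist ?j z)
      + 2 * r - 2 * ((2 * real a * real b + 2) * Q - P\<^sup>2) / (1 + r)) / (2 * (2 * real a * real b + 2))"
    unfolding J[symmetric] r[symmetric] P[symmetric] Q[symmetric] vol_spider[OF ab, symmetric]
  proof (rule kemeny_add_edge[OF verts neq nonadj resistance_spider[OF ab]])
    show "0 \<le> spider_dist ?i ?j" using r r2 by simp
    show "2 * (\<phi> x - \<phi> y) = spider_dist x ?j - spider_dist x ?i - spider_dist y ?j + spider_dist y ?i"
      for x y by (simp add: \<phi>_def field_simps)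
  qed
  also have "4 * real a * real b * kemeny ?G
      + 2 * (\<Sum>z\<in>V. d z * spider_dist ?i z) + 2 * (\<Sum>z\<in>V. d z * spider_dist ?j z) =
      4 * real a * real b * kemeny ?G
      + 2 * (2 * real b * (real a)\<^sup>2 + 2 * real a * (real b - 2) * r + 2 * ((real s)\<^sup>2 + (real t)\<^sup>2))"
    unfolding sum_deg_spider_dist[OF ab(1) m(1) st(1)] sum_deg_spider_dist[OF ab(1) m(2) st(2)] r_def
    by (simp add: algebra_simps)
  finally show ?thesis .
qed

end

subsection \<open>The polynomial inequality\<close>

text \<open>Three times \<open>r * (1 + r) \<le> Q\<close>, the sign of the slope in
  \<open>b\<close>, written additively so that it can be checked over the naturals.\<close>

lemma leg_sums_inequality:
  fixes s t a :: nat
  assumes "s \<le> t" "t \<le> a" "2 \<le> s + t" "2 \<le> a"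
  shows "4 * (s^3 + t^3) + 3 * (s + t) * (1 + s + t) \<le> 3 * (2 * a + 1) * (s^2 + t^2) + (s + t)"
proof -
  obtain e where e: "t = s + e" using assms(1) le_Suc_ex by blast
  obtain c where c: "a = t + c" using assms(2) le_Suc_ex by blast
  \<comment> \<open>In each case a shift to new nonnegative variables makes the inequality hold
    coefficientwise. The missing case \<open>s = t = a = 1\<close>, where it fails, is excluded by
    \<open>2 \<le> a\<close>.\<close>
  consider "s = 0" | "s \<ge> 2" | "s = 1" "e \<ge> 1" | "s = 1" "c \<ge> 1" using assms e c by linarith
  then show ?thesis
  proof cases
    case 1
    then obtain e' where "e = 2 + e'" using assms(3) e le_Suc_ex[of 2 e] by auto
    then show ?thesis unfolding c e 1 by (simp add: algebra_simps power2_eq_square power3_eq_cube)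
  next
    case 2
    then obtain s' where "s = 2 + s'" using le_Suc_ex by blast
    then show ?thesis unfolding c e by (simp add: algebra_simps power2_eq_square power3_eq_cube)
  next
    case 3
    then obtain e' where "e = 1 + e'" using le_Suc_ex by blast
    then show ?thesis unfolding c e 3(1) by (simp add: algebra_simps power2_eq_square power3_eq_cube)
  next
    case 4
    then obtain c' where "c = 1 + c'" using le_Suc_ex by blast
    then show ?thesis unfolding c e 4(1) by (simp add: algebra_simps power2_eq_square power3_eq_cube)
  qed
qed

text \<open>The case \<open>b = 2\<close> of the final inequality for \<open>t = s + e\<close>, \<open>a = t + c\<close>, with all negative terms moved
  across; after the shift \<open>s = 1 + s'\<close> (or \<open>e = 2 + e'\<close> when \<open>s = 0\<close>) it holds coefficientwise.\<close>

lemma path_case_inequality: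
  fixes s e c :: nat
  assumes "2 \<le> 2 * s + e"
  defines "t \<equiv> s + e" and "a \<equiv> s + e + c"
  shows "8 * (2 * a + 1) * (s^3 + t^3) + 3 * (e * (2 * c + e + 1))^2
      + (1 + s + t) * (3 * (2 * (s^2 + t^2) + (s + t)) + 4 * a^2)
    < 2 * (2 * a + 1) * (3 * (2 * a + 1) * (s^2 + t^2) + (s + t)) + (1 + s + t)"
proof (cases "s = 0")
  case True
  then obtain e' where e': "e = 2 + e'" using assms(1) le_Suc_ex[of 2 e] by auto
  show ?thesis unfolding t_def a_def True e'
    by (simp add: algebra_simps power2_eq_square power3_eq_cube)
next
  case False
  then obtain s' where s': "s = 1 + s'" using le_Suc_ex[of 1 s] by auto
  show ?thesis unfolding t_def a_def s'
    by (simp add: algebra_simps power2_eq_square power3_eq_cube)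
qed

text \<open>Both sides are expanded around \<open>b = 2\<close>: the coefficients of
  \<open>b - 2\<close> are compared by \<open>leg_sums_inequality\<close>, the remaining terms by
  \<open>path_case_inequality\<close>.\<close>

lemma kemeny_inequality_ordered:
  fixes s t a b :: nat
  assumes "s \<le> t" "t \<le> a" "2 \<le> s + t" "2 \<le> a" "2 \<le> b"
  defines "P \<equiv> (real s - real t) * (2 * real a + 1 - real s - real t)"
    and "Q \<equiv> (2 * real a + 1) * ((real s)\<^sup>2 + (real t)\<^sup>2) - 4 / 3 * ((real s)^3 + (real t)^3) + (real s + real t) / 3"
    and "r \<equiv> real s + real t"
  shows "(1 + r) * (2 * real a * (real b - 2) * r + 2 * ((real s)\<^sup>2 + (real t)\<^sup>2) + r + (4 * (real a)\<^sup>2 - 1) / 3)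
    < (2 * real a * real b + 2) * Q - P\<^sup>2"
proof -
  obtain e where e: "t = s + e" using assms(1) le_Suc_ex by blast
  obtain c where c: "a = s + e + c" using assms(2) e le_Suc_ex by blast
  have "real (4 * (s^3 + t^3) + 3 * (s + t) * (1 + s + t)) \<le> real (3 * (2 * a + 1) * (s^2 + t^2) + (s + t))"
    using leg_sums_inequality[OF assms(1-4)] by (simp only: of_nat_le_iff)
  moreover have "3 * Q = 3 * (2 * real a + 1) * ((real s)\<^sup>2 + (real t)\<^sup>2) + r - 4 * ((real s)^3 + (real t)^3)"
    by (simp add: Q_def r_def field_simps)
  ultimately have "3 * (r * (1 + r)) \<le> 3 * Q" by (simp add: r_def algebra_simps)
  then have "r * (1 + r) \<le> Q" by simp
  moreover have "0 \<le> 2 * real a * (real b - 2)" using assms(5) by simp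
  ultimately have 1: "2 * real a * (real b - 2) * (r * (1 + r)) \<le> 2 * real a * (real b - 2) * Q"
    by (rule mult_left_mono)
  \<comment> \<open>Only \<open>P\<^sup>2\<close> matters, and in this form it is the square of a
    natural number.\<close>
  have P: "P = - (real e * (2 * real c + real e + 1))"
    unfolding P_def e c by (simp add: algebra_simps)
  have "2 \<le> 2 * s + e" using assms(3) e by simp
  from path_case_inequality[OF this, of c, folded c, folded e]
  have "real (8 * (2 * a + 1) * (s^3 + t^3) + 3 * (e * (2 * c + e + 1))^2
      + (1 + s + t) * (3 * (2 * (s^2 + t^2) + (s + t)) + 4 * a^2))
    < real (2 * (2 * a + 1) * (3 * (2 * a + 1) * (s^2 + t^2) + (s + t)) + (1 + s + t))"
    by (simp only: of_nat_less_iff)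
  then have "8 * (2 * real a + 1) * ((real s)^3 + (real t)^3) + 3 * P\<^sup>2
      + (1 + r) * (3 * (2 * ((real s)\<^sup>2 + (real t)\<^sup>2) + r) + 4 * (real a)\<^sup>2)
      < 2 * (2 * real a + 1) * (3 * (2 * real a + 1) * ((real s)\<^sup>2 + (real t)\<^sup>2) + r) + (1 + r)"
    unfolding P r_def
    by (simp only: of_nat_add of_nat_mult of_nat_power of_nat_numeral of_nat_1 power2_minus add.assoc)
  \<comment> \<open>The cubes on the two sides combine into \<open>Q\<close>.\<close>
  moreover have "2 * (2 * real a + 1) * (3 * (2 * real a + 1) * ((real s)\<^sup>2 + (real t)\<^sup>2) + r)
      = 3 * (2 * (2 * real a + 1) * Q) + 8 * (2 * real a + 1) * ((real s)^3 + (real t)^3)"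
    unfolding Q_def r_def[symmetric] by (simp add: field_simps)
  ultimately have "3 * P\<^sup>2 + (1 + r) * (3 * (2 * ((real s)\<^sup>2 + (real t)\<^sup>2) + r) + 4 * (real a)\<^sup>2)
      < 3 * (2 * (2 * real a + 1) * Q) + (1 + r)" by linarith
  then have 2: "P\<^sup>2 + (1 + r) * (2 * ((real s)\<^sup>2 + (real t)\<^sup>2) + r + (4 * (real a)\<^sup>2 - 1) / 3)
      < 2 * (2 * real a + 1) * Q"
    by (simp add: field_simps)
  have "(1 + r) * (2 * real a * (real b - 2) * r + 2 * ((real s)\<^sup>2 + (real t)\<^sup>2) + r + (4 * (real a)\<^sup>2 - 1) / 3)
      = 2 * real a * (real b - 2) * (r * (1 + r))
        + (1 + r) * (2 * ((real s)\<^sup>2 + (real t)\<^sup>2) + r + (4 * (real a)\<^sup>2 - 1) / 3)"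
    by (simp add: algebra_simps)
  also have "\<dots> < 2 * real a * (real b - 2) * Q + 2 * (2 * real a + 1) * Q - P\<^sup>2"
    using 1 2 by linarith
  also have "\<dots> = (2 * real a * real b + 2) * Q - P\<^sup>2" by (simp add: algebra_simps)
  finally show ?thesis .
qed

text \<open>Exchanging \<open>s\<close> and \<open>t\<close> negates \<open>P\<close> and fixes
  \<open>Q\<close> and \<open>r\<close>, so the order of the depths is irrelevant.\<close>

lemma kemeny_inequality:
  fixes s t a b :: nat
  assumes "s \<le> a" "t \<le> a" "2 \<le> s + t" "2 \<le> a" "2 \<le> b"
  defines "P \<equiv> (real s - real t) * (2 * real a + 1 - real s - real t)"
    and "Q \<equiv> (2 * real a + 1) * ((real s)\<^sup>2 + (real t)\<^sup>2) - 4 / 3 * ((real s)^3 + (real t)^3) + (real s + real t) / 3"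
    and "r \<equiv> real s + real t"
  shows "(1 + r) * (2 * real a * (real b - 2) * r + 2 * ((real s)\<^sup>2 + (real t)\<^sup>2) + r + (4 * (real a)\<^sup>2 - 1) / 3)
    < (2 * real a * real b + 2) * Q - P\<^sup>2"
proof (cases "s \<le> t")
  case True
  then show ?thesis unfolding P_def Q_def r_def using assms by (intro kemeny_inequality_ordered)
next
  case False
  have "(real t - real s) * (2 * real a + 1 - real t - real s) = - P"
    unfolding P_def by (simp add: algebra_simps)
  then show ?thesis
    unfolding Q_def r_def using False assms(1-5) kemeny_inequality_ordered[of t s a b]
    by (simp add: add.commute)
qed

subsection \<open>Paths between pendent vertices\<close>

text \<open>The center has degree \<open>b \<ge> 2\<close> and inner leg vertices have degree 2, so
  only the ends of the legs remain.\<close>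

lemma pendent_spider:
  assumes "pendent (spider a b) u" "1 \<le> a" "2 \<le> b"
  obtains l where "l < b" "u = on_leg l a"
proof -
  have u: "u \<in> verts (spider a b)" and deg: "deg (spider a b) u = 1"
    using assms(1) by (auto simp: pendent_def deg_def)
  have "u \<noteq> Center" using deg deg_spider_Center[OF assms(2)] assms(3) by auto
  then obtain l k where k: "u = Leg l (Suc k)" "l < b" "k < a"
    using u assms(3) by (auto simp: verts_spider_eq)
  then have "Suc k = a" using deg by (auto simp: deg_spider_Leg split: if_splits)
  then show thesis using that[of l] k by (auto simp: on_leg_def)
qed

text \<open>Reversal lets the description of the first half of the path serve for the second half as
  well.\<close>

lemma path_labelling_rev:
  assumes "path_labelling G n p"
  shows "path_labelling G n (\<lambda>k. p (n + 1 - k))"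
  unfolding path_labelling_def
proof (intro conjI ballI)
  have p: "p ` {1..n} \<subseteq> verts G" "inj_on p {1..n}" "\<And>k. k \<in> {1..<n} \<Longrightarrow> {p k, p (Suc k)} \<in> edges G"
    using assms unfolding path_labelling_def by blast+
  have mem: "n + 1 - k \<in> {1..n}" if "k \<in> {1..n}" for k using that by auto
  show "(\<lambda>k. p (n + 1 - k)) ` {1..n} \<subseteq> verts G" 
  proof (rule image_subsetI)
    fix k assume "k \<in> {1..n}"
    from subsetD[OF p(1) imageI[OF mem[OF this]]] show "p (n + 1 - k) \<in> verts G" .
  qed
  show "inj_on (\<lambda>k. p (n + 1 - k)) {1..n}"
  proof (rule inj_onI)
    fix x y assume x: "x \<in> {1..n}" and y: "y \<in> {1..n}" and eq: "p (n + 1 - x) = p (n + 1 - y)"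
    have "n + 1 - x = n + 1 - y" by (rule inj_onD[OF p(2) eq mem[OF x] mem[OF y]])
    then show "x = y" using x y by auto
  qed
  fix k assume k: "k \<in> {1..<n}"
  then have "n + 1 - k = Suc (n - k)" "n + 1 - Suc k = n - k" "n - k \<in> {1..<n}" by auto
  then show "{p (n + 1 - k), p (n + 1 - Suc k)} \<in> edges G"
    using p(3)[of "n - k"] by (simp add: insert_commute)
qed

text \<open>Starting at the end of a leg, an injective path cannot turn back, so it moves straight
  to the center, which gets label \<open>a + 1\<close>.\<close>

lemma path_labelling_spider:
  assumes "path_labelling (spider a b) n p" "a + 1 \<le> n" "p 1 = on_leg l a" "l < b" "k \<le> a"
  shows "p (Suc k) = on_leg l (a - k)"
  using assms(5)
proof (induction k rule: less_induct)
  case (less k)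
  show ?case
  proof (cases k)
    case 0
    then show ?thesis using assms(3) by simp
  next
    case (Suc k')
    define q where "q = a - k"
    have q: "a - k' = Suc q" "q < a" "a - k = q" using less.prems Suc by (auto simp: q_def)
    have pk: "p k = Leg l (Suc q)" using less.IH[of k'] less.prems Suc q by simp
    have "k \<in> {1..<n}" using assms(2) less.prems Suc by simp
    then have "{p k, p (Suc k)} \<in> edges (spider a b)"
      using assms(1) unfolding path_labelling_def by blast
    then have "p (Suc k) \<in> nbrs (spider a b) (Leg l (Suc q))" using pk by (simp add: nbrs_def)
    then have "p (Suc k) = on_leg l q \<or> Suc q < a \<and> p (Suc k) = on_leg l (Suc (Suc q))"
      unfolding nbrs_spider_Leg[OF assms(4) q(2)] by (auto split: if_splits)
    \<comment> \<open>The outer neighbour of \<open>p k\<close> is its predecessor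
      \<open>p k'\<close>, so stepping there would repeat a vertex. Identifying \<open>p k'\<close>
      takes a second use of the induction hypothesis.\<close>
    moreover have False if turn: "Suc q < a" "p (Suc k) = on_leg l (Suc (Suc q))"
    proof -
      obtain k'' where k'': "k' = Suc k''" using turn(1) q(1) by (cases k') auto
      have "p k' = on_leg l (a - k'')" using less.IH[of k''] less.prems Suc k'' by simp
      moreover have "a - k'' = Suc (Suc q)" using q(1) k'' by simp
      ultimately have "p k' = p (Suc k)" using turn(2) by simp
      moreover have "inj_on p {1..n}" using assms(1) by (simp add: path_labelling_def)
      moreover have "k' \<in> {1..n}" "Suc k \<in> {1..n}" using k'' Suc less.prems assms(2) by simp_all
      ultimately have "k' = Suc k" by (metis inj_onD)
      then show False using Suc by simp
    qed
    ultimately show ?thesis using q(3) by blast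
  qed
qed

theorem theorem4p5:
  fixes a b i j :: nat and u w :: spider_vertex and p :: "nat \<Rightarrow> spider_vertex"
  assumes "a \<ge> 2" and "b \<ge> 2"
    and "pendent (spider a b) u" and "pendent (spider a b) w" and "u \<noteq> w"
    and "path_labelling (spider a b) (2 * a + 1) p" and "p 1 = u" and "p (2 * a + 1) = w"
    and "1 \<le> i" and "i < j" and "j \<le> 2 * a + 1" and "j - i \<ge> 2"
    and "i \<le> a + 1" and "a + 1 \<le> j"
  shows "kemeny (add_edge (p i) (p j) (spider a b)) - kemeny (spider a b) < 0"
proof -
  \<comment> \<open>The depths of the two endpoints. Since \<open>i \<le> a + 1 \<le> j\<close>,
    neither subtraction truncates, and \<open>s + t = j - i\<close> is the length of the path closed
    by the new edge.\<close>
  define s t where "s = a + 1 - i" and "t = j - (a + 1)"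
  have st: "s \<le> a" "t \<le> a" "2 \<le> s + t"
    using assms(9-14) by (auto simp: s_def t_def)
  have ab: "1 \<le> a" "1 \<le> b" using assms(1,2) by auto
  obtain l where l: "l < b" "u = on_leg l a" using pendent_spider[OF assms(3) ab(1) assms(2)] .
  obtain l' where l': "l' < b" "w = on_leg l' a" using pendent_spider[OF assms(4) ab(1) assms(2)] .
  have ll': "l \<noteq> l'" using assms(5) l(2) l'(2) by blast
  have "p (Suc (i - 1)) = on_leg l (a - (i - 1))"
    by (rule path_labelling_spider[OF assms(6) _ _ l(1)]) (use assms(7,13) l(2) in auto)
  then have pi: "p i = on_leg l s" using assms(9) by (simp add: s_def)
  \<comment> \<open>In the reversed labelling, \<open>j\<close> becomes
    \<open>2 * a + 2 - j\<close>, written as a successor to match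
    \<open>path_labelling_spider\<close>.\<close>
  have "p (2 * a + 1 + 1 - Suc (2 * a + 1 - j)) = on_leg l' (a - (2 * a + 1 - j))"
    by (rule path_labelling_spider[OF path_labelling_rev[OF assms(6)] _ _ l'(1)])
      (use assms(8,14) l'(2) in auto)
  moreover have "2 * a + 1 + 1 - Suc (2 * a + 1 - j) = j" "a - (2 * a + 1 - j) = t"
    using assms(11,14) by (auto simp: t_def)
  ultimately have pj: "p j = on_leg l' t" by simp
  define P where "P = (real s - real t) * (2 * real a + 1 - real s - real t)"
  define Q where "Q = (2 * real a + 1) * ((real s)\<^sup>2 + (real t)\<^sup>2)
    - 4 / 3 * ((real s)^3 + (real t)^3) + (real s + real t) / 3"
  define r where "r = real s + real t"
  define U where "U = ((2 * real a * real b + 2) * Q - P\<^sup>2) / (1 + r)"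
  define X where "X = 2 * real a * (real b - 2) * r + 2 * ((real s)\<^sup>2 + (real t)\<^sup>2) + r
    + (4 * (real a)\<^sup>2 - 1) / 3"
  define K where "K = kemeny (spider a b)"
  have "1 + r > 0" by (simp add: r_def add_pos_nonneg)
  then have "X < U"
    using kemeny_inequality[OF st assms(1,2)]
    unfolding U_def X_def P_def Q_def r_def by (simp only: pos_less_divide_eq mult.commute)
  \<comment> \<open>This accounts for the term \<open>(4 * (real a)\<^sup>2 - 1) / 3\<close> in
    \<open>X\<close>: it is \<open>2 * real b * (real a)\<^sup>2 - 2 * K\<close>.\<close>
  moreover have "2 * K = 2 * real b * (real a)\<^sup>2 - (4 * (real a)\<^sup>2 - 1) / 3"
    unfolding K_def kemeny_spider[OF ab] by (simp add: field_simps)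
  ultimately have "2 * real b * (real a)\<^sup>2 + 2 * real a * (real b - 2) * r
      + 2 * ((real s)\<^sup>2 + (real t)\<^sup>2) + r - U < 2 * K"
    unfolding X_def by linarith
  \<comment> \<open>Twice the previous inequality, with \<open>4 * real a * real b * K\<close> added
    to both sides to reach the numerator of the new constant.\<close>
  then have "4 * real a * real b * K
      + 2 * (2 * real b * (real a)\<^sup>2 + 2 * real a * (real b - 2) * r + 2 * ((real s)\<^sup>2 + (real t)\<^sup>2))
      + 2 * r - 2 * U < K * (2 * (2 * real a * real b + 2))"
    by (simp add: algebra_simps)
  moreover have "0 < 2 * (2 * real a * real b + 2)" by (simp add: add_nonneg_pos)
  ultimately have "(4 * real a * real b * K
      + 2 * (2 * real b * (real a)\<^sup>2 + 2 * real a * (real b - 2) * r + 2 * ((real s)\<^sup>2 + (real t)\<^sup>2))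
      + 2 * r - 2 * U) / (2 * (2 * real a * real b + 2)) < K"
    by (simp only: pos_divide_less_eq)
  moreover have "kemeny (add_edge (p i) (p j) (spider a b)) = (4 * real a * real b * K
      + 2 * (2 * real b * (real a)\<^sup>2 + 2 * real a * (real b - 2) * r + 2 * ((real s)\<^sup>2 + (real t)\<^sup>2))
      + 2 * r - 2 * U) / (2 * (2 * real a * real b + 2))"
    using kemeny_spider_add_edge[OF ab l(1) l'(1) ll' st]
    unfolding pi pj K_def U_def P_def Q_def r_def times_divide_eq_right .
  ultimately show ?thesis by (simp add: K_def)
qed

end
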